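(* Let $\beta\in(1,2]$ and $L>0$ be known, let $K$ satisfy the kernel assumptions, let $\alpha\in(0,1)$, and let $(f_n)_{n\ge1}$ be functions in $\Sigma(\beta,L)$ with $\varepsilon_{1,\gamma_n}(f_n)\ge2/n$, where $\gamma_n=C_\beta h_n^{\beta-1}$. Assume additionally that $D_{\gamma_n}(f_n)\cap[h_n+1/n,\,1-h_n-1/n]\ne\emptyset$, where $D_\gamma(f)=\{x\in[0,1]:f'(x)\le-\gamma\}$. Run FOMT with $C_n(\alpha)=-2\log(\alpha/2)/\varepsilon_{1,\gamma_n}(f_n)$. Then $\liminf_{n\to\infty}\mathbb P_{f_n}(\Phi=1)\ge1-\alpha$.
   Context: Model: $Y_i=f(x_i)+\varepsilon_i$, $i\in[n]=\{1,\dots,n\}$, $x_i=i/n$, $\varepsilon_i$ i.i.d. $\mathcal N(0,\sigma^2)$ with known $\sigma>0$; $\mathbb P_f$ the law under $f$. $\Sigma(\beta,L)$ ($1<\beta\le2$): differentiable $f$ with $|f'(x)-f'(y)|\le L|x-y|^{\beta-1}$. $\lambda$ Lebesgue measure; for continuously differentiable $f$ and $\gamma>0$, $\varepsilon_{1,\gamma}(f)=\lambda(\{x\in[0,1]:f'(x)\le-\gamma\})$. Kernel assumptions: $K\ge0$, $\int K=1$, support in $[-1,1]$, $K_{\min}\mathbf 1_{\{|u|\le\Delta\}}\le K\le K_{\max}$ for constants $K_{\min},K_{\max},\Delta>0$, $K$ Lipschitz with constant $L_K$, $K$ symmetric; $\mu_2=\int K^2$. LPE of order $k=\lceil\beta\rceil-1=1$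 with bandwidth $h$: $U(u)=(1,u)^\top$, $\mathcal B_{nx}=\frac1{nh}\sum_iU(\tfrac{x_i-x}h)U(\tfrac{x_i-x}h)^\top K(\tfrac{x_i-x}h)$, $\hat f_n(x)=\sum_iW_{ni}(x)Y_i$, $W_{ni}(x)=\frac1{nh}U(0)^\top\mathcal B_{nx}^{-1}U(\tfrac{x_i-x}h)K(\tfrac{x_i-x}h)$. $\lambda_0>0$ lower-bounds the smallest eigenvalue of $\mathcal B_{nx}$ for all $x$ and large $n$ (paper: $\lambda_0=0.0228$). Constants: $C_*=8K_{\max}/\lambda_0$, $q_1=C_*L$, $q_2=32\sigma^2\mu_2/\lambda_0^2$, $C_h=(q_2/(4q_1^2\beta))^{1/(2\beta+1)}$, $h_n=C_h(\log n/n)^{1/(2\beta+1)}$; $L_1=\sqrt e(K_{\max}+L_K)$, $L_2=4K_{\max}+2L_K$, $\widetilde C_*=L_1/(8L_2)+\sqrt eK_{\max}/\lambda_0$, $W=\max(4C_*^2,4\widetilde C_*^2)$; $C_\beta=4L+\frac{16L_2\sigma}{\lambda_0}\sqrt{4W/C_h^{2\beta+1}}$. FOMT: $N_{\max}=\frac{40}{\log2}C_n(\alpha)(\log n)^2$; $T_{i,j}=\hat f_n(x_i)-\hat f_n(x_j)$ (bandwidth $h_n$); $C_{n,\alpha,i,j}=\sigma\sqrt{-2\log(\alpha/N_{\max})W}\,n^{-1/2}h_n^{-3/2}(\tfrac{8L_2}{\lambda_0}|x_i-x_j|\wedge h_n)$; $D_{n,\beta,i,j}=0$ if $x_i,x_j\in[h_n,1-h_n]$,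 else $(\tfrac{16K_{\max}}{\lambda_0}\vee2)Lh_n^\beta$; $\Phi_{i,j}=\mathbf 1\{T_{i,j}\ge C_{n,\alpha,i,j}+D_{n,\beta,i,j}\}$. $\Phi$: repeat $C_n(\alpha)$ times: draw $I\sim\mathrm{Unif}([n])$; if $I\le n-1$, repeat $\lceil20\log n\rceil$ times: for $k=0,\dots,\lceil\log_2(n-I)\rceil$ draw $J_k\sim\mathrm{Unif}\{1,\dots,\min(2^k,n-I)\}$, output $\Phi=1$ and stop if $\Phi_{I,I+J_k}=1$; if $I\ge2$, repeat $\lceil20\log n\rceil$ times: for $k=0,\dots,\lceil\log_2(I-1)\rceil$ draw $J'_k\sim\mathrm{Unif}\{1,\dots,\min(2^k,I-1)\}$, output $\Phi=1$ and stop if $\Phi_{I-J'_k,I}=1$; otherwise output $\Phi=0$. Draws independent of each other and of the data. *)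

theory Defs
  imports "HOL-Probability.Probability"
begin

definition xpt :: "nat \<Rightarrow> nat \<Rightarrow> real" where
  "xpt n i = real i / real n"

definition in_Sigma :: "real \<Rightarrow> real \<Rightarrow> (real \<Rightarrow> real) \<Rightarrow> (real \<Rightarrow> real) \<Rightarrow> bool" where
  "in_Sigma \<beta> L f f' \<longleftrightarrow>
     (\<forall>x\<in>{0..1}. (f has_real_derivative f' x) (at x within {0..1})) \<and>
     (\<forall>x\<in>{0..1}. \<forall>y\<in>{0..1}. \<bar>f' x - f' y\<bar> \<le> L * \<bar>x - y\<bar> powr (\<beta> - 1))"

definition Dset :: "real \<Rightarrow> (real \<Rightarrow> real) \<Rightarrow> real set" where
  "Dset \<gamma> f' = {x\<in>{0..1}. f' x \<le> - \<gamma>}"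

definition eps1 :: "real \<Rightarrow> (real \<Rightarrow> real) \<Rightarrow> real" where
  "eps1 \<gamma> f' = measure lebesgue (Dset \<gamma> f')"

text \<open>Entries s_k(x) of B_{nx}: B_{nx} = [[s0, s1],[s1, s2]].\<close>
definition lpe_s :: "(real \<Rightarrow> real) \<Rightarrow> nat \<Rightarrow> real \<Rightarrow> real \<Rightarrow> nat \<Rightarrow> real" where
  "lpe_s K n h x k = (1 / (real n * h)) *
     (\<Sum>i=1..n. ((xpt n i - x) / h) ^ k * K ((xpt n i - x) / h))"

definition lpe_min_eig :: "(real \<Rightarrow> real) \<Rightarrow> nat \<Rightarrow> real \<Rightarrow> real \<Rightarrow> real" where
  "lpe_min_eig K n h x =
     (let a = lpe_s K n h x 0; b = lpe_s K n h x 1; c = lpe_s K n h x 2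
      in (a + c) / 2 - sqrt (((a - c) / 2)\<^sup>2 + b\<^sup>2))"

text \<open>W_{ni}(x) = (1/(nh)) U(0)^T B^{-1} U(u) K(u), u = (x_i - x)/h, with the
  2x2 inverse written out: U(0)^T B^{-1} U(u) = (s2 - s1 u)/(s0 s2 - s1^2).\<close>
definition lpe_weight :: "(real \<Rightarrow> real) \<Rightarrow> nat \<Rightarrow> real \<Rightarrow> real \<Rightarrow> nat \<Rightarrow> real" where
  "lpe_weight K n h x i =
     (let a = lpe_s K n h x 0; b = lpe_s K n h x 1; c = lpe_s K n h x 2;
          u = (xpt n i - x) / h
      in (1 / (real n * h)) * ((c - b * u) / (a * c - b\<^sup>2)) * K u)"

definition lpe :: "(real \<Rightarrow> real) \<Rightarrow> nat \<Rightarrow> real \<Rightarrow> (nat \<Rightarrow> real) \<Rightarrow> real \<Rightarrow> real" where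
  "lpe K n h Y x = (\<Sum>i=1..n. lpe_weight K n h x i * Y i)"

definition mu2 :: "(real \<Rightarrow> real) \<Rightarrow> real" where
  "mu2 K = integral UNIV (\<lambda>u. (K u)\<^sup>2)"

definition Cstar :: "real \<Rightarrow> real \<Rightarrow> real" where
  "Cstar Kmax lam0 = 8 * Kmax / lam0"

definition Ch :: "real \<Rightarrow> real \<Rightarrow> real \<Rightarrow> (real \<Rightarrow> real) \<Rightarrow> real \<Rightarrow> real \<Rightarrow> real" where
  "Ch \<beta> L \<sigma> K Kmax lam0 =
     (let q1 = Cstar Kmax lam0 * L; q2 = 32 * \<sigma>\<^sup>2 * mu2 K / lam0\<^sup>2
      in (q2 / (4 * q1\<^sup>2 * \<beta>)) powr (1 / (2 * \<beta> + 1)))"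

definition bw :: "real \<Rightarrow> real \<Rightarrow> real \<Rightarrow> (real \<Rightarrow> real) \<Rightarrow> real \<Rightarrow> real \<Rightarrow> nat \<Rightarrow> real" where
  "bw \<beta> L \<sigma> K Kmax lam0 n = Ch \<beta> L \<sigma> K Kmax lam0 * (ln (real n) / real n) powr (1 / (2 * \<beta> + 1))"

definition L1c :: "real \<Rightarrow> real \<Rightarrow> real" where
  "L1c Kmax LK = sqrt (exp 1) * (Kmax + LK)"

definition L2c :: "real \<Rightarrow> real \<Rightarrow> real" where
  "L2c Kmax LK = 4 * Kmax + 2 * LK"

definition Ctil :: "real \<Rightarrow> real \<Rightarrow> real \<Rightarrow> real" where
  "Ctil Kmax LK lam0 = L1c Kmax LK / (8 * L2c Kmax LK) + sqrt (exp 1) * Kmax / lam0"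

definition Wc :: "real \<Rightarrow> real \<Rightarrow> real \<Rightarrow> real" where
  "Wc Kmax LK lam0 = max (4 * (Cstar Kmax lam0)\<^sup>2) (4 * (Ctil Kmax LK lam0)\<^sup>2)"

definition Cbeta :: "real \<Rightarrow> real \<Rightarrow> real \<Rightarrow> (real \<Rightarrow> real) \<Rightarrow> real \<Rightarrow> real \<Rightarrow> real \<Rightarrow> real" where
  "Cbeta \<beta> L \<sigma> K Kmax LK lam0 =
     4 * L + 16 * L2c Kmax LK * \<sigma> / lam0 *
       sqrt (4 * Wc Kmax LK lam0 / Ch \<beta> L \<sigma> K Kmax lam0 powr (2 * \<beta> + 1))"

definition gam :: "real \<Rightarrow> real \<Rightarrow> real \<Rightarrow> (real \<Rightarrow> real) \<Rightarrow> real \<Rightarrow> real \<Rightarrow> real \<Rightarrow> nat \<Rightarrow> real" where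
  "gam \<beta> L \<sigma> K Kmax LK lam0 n =
     Cbeta \<beta> L \<sigma> K Kmax LK lam0 * bw \<beta> L \<sigma> K Kmax lam0 n powr (\<beta> - 1)"

definition fomt_stat ::
  "real \<Rightarrow> real \<Rightarrow> real \<Rightarrow> (real \<Rightarrow> real) \<Rightarrow> real \<Rightarrow> real \<Rightarrow> real \<Rightarrow> real \<Rightarrow> real \<Rightarrow> nat
    \<Rightarrow> (nat \<Rightarrow> real) \<Rightarrow> nat \<Rightarrow> nat \<Rightarrow> bool" where
  "fomt_stat \<beta> L \<sigma> K Kmax LK lam0 \<alpha> Cn n Y i j =
     (let h = bw \<beta> L \<sigma> K Kmax lam0 n;
          xi = xpt n i; xj = xpt n j;
          T = lpe K n h Y xi - lpe K n h Y xj;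
          Nmax = 40 / ln 2 * Cn * (ln (real n))\<^sup>2;
          C = \<sigma> * sqrt (- 2 * ln (\<alpha> / Nmax) * Wc Kmax LK lam0) * real n powr (-1/2)
                * h powr (-3/2) * min (8 * L2c Kmax LK / lam0 * \<bar>xi - xj\<bar>) h;
          D = (if xi \<in> {h..1-h} \<and> xj \<in> {h..1-h} then 0
               else max (16 * Kmax / lam0) 2 * L * h powr \<beta>)
      in T \<ge> C + D)"

fun any_list :: "bool pmf list \<Rightarrow> bool pmf" where
  "any_list [] = return_pmf False"
| "any_list (p # ps) = bind_pmf p (\<lambda>b. if b then return_pmf True else any_list ps)"

fun rep_pmf :: "nat \<Rightarrow> bool pmf \<Rightarrow> bool pmf" where
  "rep_pmf 0 p = return_pmf False"
| "rep_pmf (Suc m) p = bind_pmf p (\<lambda>b. if b then return_pmf True else rep_pmf m p)"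

definition or_pmf :: "bool pmf \<Rightarrow> bool pmf \<Rightarrow> bool pmf" where
  "or_pmf p q = bind_pmf p (\<lambda>b. if b then return_pmf True else q)"

definition right_block :: "nat \<Rightarrow> nat \<Rightarrow> (nat \<Rightarrow> nat \<Rightarrow> bool) \<Rightarrow> nat \<Rightarrow> bool pmf" where
  "right_block n R Phi I =
     rep_pmf R (any_list (map (\<lambda>k. map_pmf (\<lambda>j. Phi I (I + j)) (pmf_of_set {1..min (2 ^ k) (n - I)}))
                              [0..<nat \<lceil>log 2 (real (n - I))\<rceil> + 1]))"

definition left_block :: "nat \<Rightarrow> (nat \<Rightarrow> nat \<Rightarrow> bool) \<Rightarrow> nat \<Rightarrow> bool pmf" where
  "left_block R Phi I =
     rep_pmf R (any_list (map (\<lambda>k. map_pmf (\<lambda>j. Phi (I - j) I) (pmf_of_set {1..min (2 ^ k) (I - 1)}))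
                              [0..<nat \<lceil>log 2 (real (I - 1))\<rceil> + 1]))"

definition fomt_iter :: "nat \<Rightarrow> nat \<Rightarrow> (nat \<Rightarrow> nat \<Rightarrow> bool) \<Rightarrow> bool pmf" where
  "fomt_iter n R Phi =
     bind_pmf (pmf_of_set {1..n}) (\<lambda>I.
       or_pmf (if I \<le> n - 1 then right_block n R Phi I else return_pmf False)
              (if 2 \<le> I then left_block R Phi I else return_pmf False))"

definition fomt_pmf :: "nat \<Rightarrow> nat \<Rightarrow> (nat \<Rightarrow> nat \<Rightarrow> bool) \<Rightarrow> bool pmf" where
  "fomt_pmf n m Phi = rep_pmf m (fomt_iter n (nat \<lceil>20 * ln (real n)\<rceil>) Phi)"

definition data_law :: "real \<Rightarrow> (real \<Rightarrow> real) \<Rightarrow> nat \<Rightarrow> (nat \<Rightarrow> real) measure" where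
  "data_law \<sigma> f n = PiM {1..n} (\<lambda>i. density lborel (normal_density (f (xpt n i)) \<sigma>))"

text \<open>P_f(Phi = 1): the internal draws are independent of the data.\<close>
definition reject_prob :: "real \<Rightarrow> (real \<Rightarrow> real) \<Rightarrow> nat \<Rightarrow> ((nat \<Rightarrow> real) \<Rightarrow> bool pmf) \<Rightarrow> real" where
  "reject_prob \<sigma> f n test = (\<integral>Y. pmf (test Y) True \<partial>data_law \<sigma> f n)"

end

(* Let D be the set where f' <= -gamma_n.  At least a fraction eps = lambda(D) of the grid points lies within
   1/n of D.  Around such a point x_I the Hoelder condition keeps f' <= -(C_beta - 2L) h^(beta-1) on a
   window of width h, so f drops by order C_beta h^beta between x_I and any x_J at distance in [h/2, h], taken on
   whichever side of x_I stays inside [0,1].  This beats both thresholds and the bias of the estimator by a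
   constant multiple of h^beta, also at the boundary, because C_beta is a large multiple of L K_max/lambda_0.
   The standard deviation of the statistic is of order (n h)^(-1/2) = O(h^beta / sqrt(log n)), so Chebyshev's
   inequality already shows that each such pair is accepted with probability O(1/log n).
   The scan at the scale 2^k with k = ceil(log_2 (n h)) hits a good J with probability at least 1/8, so
   20 log n repetitions find one with probability tending to 1; hence an iteration started at a good I rejects
   with conditional probability at least 1/2 outside an event of vanishing probability, and
   (1 - eps/2)^(C_n) <= exp(-eps C_n/2) = alpha/2. *)

theory Submission
  imports Defs "HOL-Real_Asymp.Real_Asymp"
begin

section \<open>The randomised scan\<close>

lemma pmf_or_pmf_False: "pmf (or_pmf p q) False = pmf p False * pmf q False"
  unfolding or_pmf_def pmf_bind
  by (subst integral_measure_pmf_real[of UNIV]) (auto simp: UNIV_bool)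

lemma pmf_rep_pmf_False: "pmf (rep_pmf m p) False = pmf p False ^ m"
proof (induction m)
  case (Suc m)
  have "rep_pmf (Suc m) p = or_pmf p (rep_pmf m p)" by (simp only: or_pmf_def rep_pmf.simps)
  then show ?case by (simp only: pmf_or_pmf_False Suc power_Suc)
qed simp

lemma pmf_any_list_False: "pmf (any_list ps) False = (\<Prod>p\<leftarrow>ps. pmf p False)"
proof (induction ps)
  case (Cons p ps)
  have "any_list (p # ps) = or_pmf p (any_list ps)" by (simp only: or_pmf_def any_list.simps)
  then show ?case by (simp only: pmf_or_pmf_False Cons list.map prod_list.Cons)
qed simp

lemma pmf_False_eq: "pmf p False = 1 - pmf p True"
proof -
  have "(\<Sum>b\<in>UNIV. pmf p b) = 1" by (rule sum_pmf_eq_1) auto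
  then show ?thesis by (simp add: UNIV_bool)
qed

lemma prod_list_unit_interval:
  fixes xs :: "real list"
  assumes "\<And>x. x \<in> set xs \<Longrightarrow> 0 \<le> x \<and> x \<le> 1"
  shows "0 \<le> prod_list xs \<and> prod_list xs \<le> 1"
  using assms by (induction xs) (simp_all add: mult_le_one)

text \<open>A pass over the scales fails only if every scale fails, so its failure probability is a
  product; this allows all scales but one to be dropped from it.\<close>

lemma prod_list_le_nth:
  fixes xs :: "real list"
  assumes "\<And>x. x \<in> set xs \<Longrightarrow> 0 \<le> x \<and> x \<le> 1" and "k < length xs"
  shows "0 \<le> prod_list xs \<and> prod_list xs \<le> xs ! k"
  using assms
proof (induction xs arbitrary: k)
  case (Cons x xs)
  have 0: "0 \<le> prod_list xs \<and> prod_list xs \<le> 1"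
    using Cons.prems(1) prod_list_unit_interval[of xs] by simp
  show ?case
  proof (cases k)
    case 0
    then show ?thesis using \<open>0 \<le> prod_list xs \<and> prod_list xs \<le> 1\<close> Cons.prems(1)[of x]
      by (auto intro: mult_right_le_one_le)
  next
    case (Suc l)
    then have "prod_list xs \<le> xs ! l" using Cons.IH[of l] Cons.prems by auto
    moreover have "x * prod_list xs \<le> prod_list xs"
      using 0 Cons.prems(1)[of x] by (auto intro: mult_left_le_one_le)
    ultimately show ?thesis using 0 Suc Cons.prems(1)[of x] by auto
  qed
qed simp

text \<open>Common form of \<open>right_block\<close> and \<open>left_block\<close>:
  \<open>N\<close> is the room on the chosen side, and \<open>psi j\<close> says whether the pair at
  index distance \<open>j\<close> rejects.\<close>

definition scan_block :: "nat \<Rightarrow> nat \<Rightarrow> (nat \<Rightarrow> bool) \<Rightarrow> bool pmf" where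
  "scan_block R N psi =
     rep_pmf R (any_list (map (\<lambda>k. map_pmf psi (pmf_of_set {1..min (2 ^ k) N}))
                              [0..<nat \<lceil>log 2 (real N)\<rceil> + 1]))"

lemma right_block_eq: "right_block n R Phi I = scan_block R (n - I) (\<lambda>j. Phi I (I + j))"
  by (simp add: right_block_def scan_block_def)

lemma left_block_eq: "left_block R Phi I = scan_block R (I - 1) (\<lambda>j. Phi (I - j) I)"
  by (simp add: left_block_def scan_block_def)

text \<open>With \<open>t = n * h\<close> these are the index distances of design points that lie
  between h/2 and h apart, where the local test has power.\<close>

definition scan_window :: "real \<Rightarrow> nat set" where
  "scan_window t = {j. t / 2 \<le> real j \<and> real j \<le> t}"

lemma scan_window_eq: "0 \<le> t \<Longrightarrow> scan_window t = {nat \<lceil>t / 2\<rceil>..nat \<lfloor>t\<rfloor>}"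
  unfolding scan_window_def by (auto simp: nat_le_iff le_nat_iff ceiling_le_iff le_floor_iff)

lemma finite_scan_window: "finite (scan_window t)"
proof -
  have "scan_window t \<subseteq> {..nat \<lfloor>t\<rfloor>}"
    unfolding scan_window_def by (auto simp: le_nat_iff le_floor_iff)
  then show ?thesis by (rule finite_subset) simp
qed

text \<open>An interval of length t/2 holds at least t/2 - 1 integers, and this is at least t/4 once
  t >= 4.\<close>

lemma card_scan_window: "4 \<le> t \<Longrightarrow> t / 4 \<le> real (card (scan_window t))"
  by (simp add: scan_window_eq) linarith

lemma pmf_map_pmf_of_set_False:
  assumes "finite S" "S \<noteq> {}"
  shows "pmf (map_pmf psi (pmf_of_set S)) False = real (card {j\<in>S. \<not> psi j}) / real (card S)"
proof -
  have "S \<inter> psi -` {False} = {j\<in>S. \<not> psi j}" by auto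
  then show ?thesis using assms
    by (simp add: pmf_map measure_pmf_of_set)
qed

lemma pmf_map_pmf_of_set_False_sum:
  assumes "finite S" "S \<noteq> {}"
  shows "pmf (map_pmf psi (pmf_of_set S)) False = (\<Sum>j\<in>S. of_bool (\<not> psi j)) / real (card S)"
proof -
  have "(\<Sum>j\<in>S. of_bool (\<not> psi j) :: real) = real (card {j\<in>S. \<not> psi j})"
    using assms by (simp add: Collect_conj_eq Int_commute)
  then show ?thesis using assms by (simp add: pmf_map_pmf_of_set_False)
qed

text \<open>The scale \<open>k = \<lceil>log\<^sub>2 t\<rceil>\<close> puts mass at least 1/8 on the window \<open>[t/2, t]\<close>.\<close>
lemma pmf_scan_block_False_le:
  assumes t: "4 \<le> t" "t \<le> real N"
  shows "pmf (scan_block R N psi) False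
    \<le> (15/16) ^ R + 2 * ((\<Sum>j\<in>scan_window t. of_bool (\<not> psi j)) / real (card (scan_window t)))"
proof -
  define k where "k = nat \<lceil>log 2 t\<rceil>"
  define S where "S = {1..min (2 ^ k) N}"
  define b where "b = (\<Sum>j\<in>scan_window t. of_bool (\<not> psi j)) / real (card (scan_window t))"
  let ?w = "real (card (scan_window t))"
  have log: "0 \<le> log 2 t" using t by simp
  have "log 2 t \<le> real k" unfolding k_def using log by linarith
  then have "t \<le> 2 powr real k" using t by (simp add: log_le_iff)
  then have k1: "t \<le> 2 ^ k" by (simp add: powr_realpow)
  have "real k \<le> log 2 t + 1" unfolding k_def using log by linarith
  then have "2 powr real k \<le> 2 powr (log 2 t + 1)" by simp
  then have k2: "2 ^ k \<le> 2 * t" using t by (simp add: powr_realpow powr_add)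
  \<comment> \<open>Since t <= N, the chosen scale is among those that are scanned.\<close>
  have klen: "k < nat \<lceil>log 2 (real N)\<rceil> + 1"
  proof -
    have "log 2 t \<le> log 2 (real N)" using t by simp
    then have "\<lceil>log 2 t\<rceil> \<le> \<lceil>log 2 (real N)\<rceil>" by (rule ceiling_mono)
    then show ?thesis unfolding k_def by linarith
  qed
  have w: "t / 4 \<le> ?w" using card_scan_window t by simp
  have S: "finite S" "S \<noteq> {}" using t unfolding S_def by auto
  have cS: "real (card S) \<le> 2 * t" "0 < real (card S)"
  proof -
    have "real (card S) \<le> real (2 ^ k)" unfolding S_def by (simp only: of_nat_le_iff) simp
    then show "real (card S) \<le> 2 * t" using k2 unfolding of_nat_power of_nat_numeral by linarith
    show "0 < real (card S)" using S by (simp add: card_gt_0_iff)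
  qed
  have sub: "scan_window t \<subseteq> S"
  proof
    fix j assume "j \<in> scan_window t"
    then have j: "t / 2 \<le> real j" "real j \<le> t" by (auto simp: scan_window_def)
    have "real j \<le> real (2 ^ k)" using j k1 unfolding of_nat_power of_nat_numeral by linarith
    then have "j \<le> 2 ^ k" by (simp only: of_nat_le_iff)
    moreover have "real j \<le> real N" using j t by linarith
    ultimately show "j \<in> S" using j t unfolding S_def by auto
  qed
  define g where "g = real (card {j\<in>scan_window t. psi j})"
  have split_w: "?w = g + (\<Sum>j\<in>scan_window t. of_bool (\<not> psi j))"
  proof -
    have "(\<Sum>j\<in>scan_window t. of_bool (\<not> psi j) :: real) = real (card {j\<in>scan_window t. \<not> psi j})"
      using finite_scan_window by (simp add: Collect_conj_eq Int_commute)
    moreover have "card (scan_window t) = card {j\<in>scan_window t. psi j} + card {j\<in>scan_window t. \<not> psi j}"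
      using finite_scan_window by (subst card_Un_disjoint[symmetric]) (auto intro: arg_cong[where f=card])
    ultimately show ?thesis unfolding g_def by simp
  qed
  have wpos: "0 < ?w" using w t by linarith
  have g: "g = (1 - b) * ?w" using split_w wpos unfolding b_def by (simp add: field_simps)
  have b01: "0 \<le> b" "b \<le> 1"
    using split_w wpos unfolding b_def g_def by (auto intro!: divide_nonneg_pos sum_nonneg)
  have "real (card {j\<in>S. \<not> psi j}) \<le> real (card S) - g"
  proof -
    have "card {j\<in>S. \<not> psi j} + card {j\<in>scan_window t. psi j} \<le> card S"
      using S sub finite_scan_window by (subst card_Un_disjoint[symmetric]) (auto intro!: card_mono)
    then show ?thesis unfolding g_def by linarith
  qed
  then have "pmf (map_pmf psi (pmf_of_set S)) False \<le> (real (card S) - g) / real (card S)"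
    using S by (simp add: pmf_map_pmf_of_set_False divide_right_mono)
  also have "\<dots> = 1 - g / real (card S)" using cS by (simp add: field_simps)
  \<comment> \<open>The window has at least t/4 elements and the sampling range at most 2t, so a
    draw lands in the window with probability at least 1/8; a fraction \<open>1 - b\<close> of the
    window rejects.\<close>
  also have "\<dots> \<le> 1 - (1 - b) / 8"
  proof -
    have "(1 - b) * (real (card S) / 8) \<le> (1 - b) * ?w"
      using cS w b01 by (intro mult_left_mono) auto
    then show ?thesis using cS g by (simp add: field_simps)
  qed
  finally have one: "pmf (map_pmf psi (pmf_of_set S)) False \<le> 1 - (1 - b) / 8" .
  let ?ps = "map (\<lambda>k. map_pmf psi (pmf_of_set {1..min (2 ^ k) N})) [0..<nat \<lceil>log 2 (real N)\<rceil> + 1]"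
  have "(\<Prod>p\<leftarrow>?ps. pmf p False) \<le> map (\<lambda>p. pmf p False) ?ps ! k"
    using klen by (intro conjunct2[OF prod_list_le_nth]) (auto simp: pmf_le_1)
  also have "\<dots> \<le> 1 - (1 - b) / 8"
    using one klen unfolding S_def by (simp del: upt_Suc add: nth_append)
  finally have "pmf (any_list ?ps) False \<le> 1 - (1 - b) / 8"
    by (simp only: pmf_any_list_False)
  then have "pmf (scan_block R N psi) False \<le> (1 - (1 - b) / 8) ^ R"
    unfolding scan_block_def pmf_rep_pmf_False by (rule power_mono) simp
  \<comment> \<open>If \<open>b\<close> is at most 1/2, every repetition succeeds with probability
    at least 1/16; otherwise \<open>2 * b\<close> exceeds 1 and the bound is trivial. The result is
    linear in \<open>b\<close>, so that it can be integrated over the data.\<close>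
  also have "\<dots> \<le> (15/16) ^ R + 2 * b"
  proof (cases "b \<le> 1/2")
    case True
    then have "(1 - (1 - b) / 8) ^ R \<le> (15/16) ^ R" using b01 by (intro power_mono) auto
    then show ?thesis using b01 by linarith
  next
    case False
    have "(1 - (1 - b) / 8) ^ R \<le> 1" using b01 by (intro power_le_one) auto
    moreover have "(0::real) \<le> (15/16) ^ R" by simp
    ultimately show ?thesis using False by linarith
  qed
  finally show ?thesis unfolding b_def .
qed

text \<open>Probability that an iteration started at \<open>I\<close> does not reject: the two sides
  are scanned independently, and a side without points contributes the factor 1.\<close>

definition iter_fail :: "nat \<Rightarrow> nat \<Rightarrow> (nat \<Rightarrow> nat \<Rightarrow> bool) \<Rightarrow> nat \<Rightarrow> real" where
  "iter_fail n R Phi I =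
     (if I \<le> n - 1 then pmf (right_block n R Phi I) False else 1) *
     (if 2 \<le> I then pmf (left_block R Phi I) False else 1)"

lemma iter_fail_le:
  shows "iter_fail n R Phi I \<le> 1" "0 \<le> iter_fail n R Phi I"
    "I \<le> n - 1 \<Longrightarrow> iter_fail n R Phi I \<le> pmf (right_block n R Phi I) False"
    "2 \<le> I \<Longrightarrow> iter_fail n R Phi I \<le> pmf (left_block R Phi I) False"
  unfolding iter_fail_def
  by (auto intro!: mult_le_one pmf_le_1 mult_left_le_one_le mult_right_le_one_le)

lemma pmf_fomt_iter_False:
  assumes "1 \<le> n"
  shows "pmf (fomt_iter n R Phi) False = (\<Sum>I=1..n. iter_fail n R Phi I) / real n"
proof -
  have "pmf (fomt_iter n R Phi) False = (\<Sum>I=1..n. pmf (or_pmf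
              (if I \<le> n - 1 then right_block n R Phi I else return_pmf False)
              (if 2 \<le> I then left_block R Phi I else return_pmf False)) False) / real n"
    unfolding fomt_iter_def pmf_bind using assms by (subst integral_pmf_of_set) auto
  also have "\<dots> = (\<Sum>I=1..n. iter_fail n R Phi I) / real n"
    by (intro arg_cong2[where f="(/)"] sum.cong) (auto simp: pmf_or_pmf_False iter_fail_def)
  finally show ?thesis .
qed

text \<open>Starting points outside \<open>G\<close> are counted as certain failures. If the mean
  \<open>g\<close> of \<open>r\<close> over \<open>G\<close> is at most 1/2, an iteration rejects
  with probability at least |G|/(2n), and 1 - x <= exp(-x) gives the exponential; if
  \<open>g\<close> is larger, the term \<open>2 * g\<close> already exceeds 1.\<close>

lemma pmf_fomt_pmf_False_le:
  assumes G: "G \<subseteq> {1..n}" "G \<noteq> {}"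
    and r: "\<And>I. I \<in> G \<Longrightarrow> iter_fail n (nat \<lceil>20 * ln (real n)\<rceil>) Phi I \<le> r I"
  shows "pmf (fomt_pmf n m Phi) False
    \<le> exp (- (real (card G) / real n * real m / 2)) + 2 * ((\<Sum>I\<in>G. r I) / real (card G))"
proof -
  let ?R = "nat \<lceil>20 * ln (real n)\<rceil>"
  define q where "q = pmf (fomt_iter n ?R Phi) False"
  define g where "g = (\<Sum>I\<in>G. r I) / real (card G)"
  have fG: "finite G" using G finite_subset by blast
  then have cG: "0 < real (card G)" using G by (simp add: card_gt_0_iff)
  have n: "1 \<le> n" using G by auto
  have "(\<Sum>I=1..n. iter_fail n ?R Phi I)
      = (\<Sum>I\<in>G. iter_fail n ?R Phi I) + (\<Sum>I\<in>{1..n} - G. iter_fail n ?R Phi I)"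
    using G fG by (metis add.commute finite_atLeastAtMost sum.subset_diff)
  also have "(\<Sum>I\<in>G. iter_fail n ?R Phi I) \<le> g * real (card G)"
    using r cG unfolding g_def by (auto intro!: sum_mono)
  also have "(\<Sum>I\<in>{1..n} - G. iter_fail n ?R Phi I) \<le> real (card ({1..n} - G))"
    using iter_fail_le(1) sum_bounded_above[of "{1..n} - G" "iter_fail n ?R Phi" 1] by simp
  also have "real (card ({1..n} - G)) = real n - real (card G)"
    using G fG card_mono[of "{1..n}" G] by (simp add: card_Diff_subset of_nat_diff)
  finally have "q \<le> (g * real (card G) + (real n - real (card G))) / real n"
    unfolding q_def pmf_fomt_iter_False[OF n] by (simp add: divide_right_mono)
  also have "\<dots> = 1 - real (card G) / real n * (1 - g)"
    using n by (simp add: field_simps)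
  finally have q: "q \<le> 1 - real (card G) / real n * (1 - g)" .
  have g0: "0 \<le> g" unfolding g_def
    using r iter_fail_le(2) by (intro divide_nonneg_pos sum_nonneg cG) (meson order_trans)
  have "q ^ m \<le> exp (- (real (card G) / real n * real m / 2)) + 2 * g"
  proof (cases "g \<le> 1/2")
    case True
    have "real (card G) / real n * (1/2) \<le> real (card G) / real n * (1 - g)"
      using True by (intro mult_left_mono) auto
    then have "q \<le> 1 + - (real (card G) / real n / 2)" using q by simp
    also have "\<dots> \<le> exp (- (real (card G) / real n / 2))" by (rule exp_ge_add_one_self)
    finally have "q ^ m \<le> exp (- (real (card G) / real n / 2)) ^ m"
      unfolding q_def by (intro power_mono) auto
    also have "\<dots> = exp (- (real (card G) / real n * real m / 2))"
      by (simp flip: exp_of_nat_mult add: field_simps)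
    finally show ?thesis using g0 by simp
  next
    case False
    have "q ^ m \<le> 1" unfolding q_def by (intro power_le_one) (auto simp: pmf_le_1)
    then show ?thesis using False exp_ge_zero[of "- (real (card G) / real n * real m / 2)"]
      by linarith
  qed
  then show ?thesis unfolding fomt_pmf_def pmf_rep_pmf_False q_def g_def .
qed

section \<open>Measurability in the data and averaging over it\<close>

lemma measurable_pmf_scan_block [measurable]:
  assumes [measurable]: "\<And>j. 1 \<le> j \<Longrightarrow> j \<le> N \<Longrightarrow> Measurable.pred M (\<lambda>Y. psi Y j)" and N: "1 \<le> N"
  shows "(\<lambda>Y. pmf (scan_block R N (psi Y)) False) \<in> borel_measurable M"
proof -
  have "(\<lambda>Y. \<Prod>k\<leftarrow>ks. pmf (map_pmf (psi Y) (pmf_of_set {1..min (2 ^ k) N})) False)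
      \<in> borel_measurable M" for ks :: "nat list"
  proof (induction ks)
    case (Cons k ks)
    have "(\<lambda>Y. \<Sum>j\<in>{1..min (2 ^ k) N}. of_bool (\<not> psi Y j) :: real) \<in> borel_measurable M"
      by (intro borel_measurable_sum) (auto intro!: measurable_compose[OF _ measurable_of_bool])
    note [measurable] = this
    have [measurable]: "(\<lambda>Y. pmf (map_pmf (psi Y) (pmf_of_set {1..min (2 ^ k) N})) False)
        \<in> borel_measurable M"
      using N by (subst pmf_map_pmf_of_set_False_sum) (auto simp del: sum_of_bool_eq)
    show ?case unfolding list.map prod_list.Cons by (intro borel_measurable_times Cons) measurable
  qed simp
  then show ?thesis unfolding scan_block_def pmf_rep_pmf_False pmf_any_list_False map_map comp_def
    by (intro borel_measurable_power) 
qed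

text \<open>For fixed data the failure probability is built from finitely many indicators of local
  tests by averages, products and powers, so it inherits their measurability; this makes the
  integral over the data meaningful.\<close>

lemma measurable_pmf_fomt_pmf:
  assumes Phi: "\<And>i j. i \<in> {1..n} \<Longrightarrow> j \<in> {1..n} \<Longrightarrow> Measurable.pred M (\<lambda>Y. Phi Y i j)" and n: "1 \<le> n"
  shows "(\<lambda>Y. pmf (fomt_pmf n m (Phi Y)) False) \<in> borel_measurable M"
proof -
  have "(\<lambda>Y. iter_fail n R (Phi Y) I) \<in> borel_measurable M" if "I \<in> {1..n}" for I R
  proof -
    have [measurable]: "(\<lambda>Y. if I \<le> n - 1 then pmf (right_block n R (Phi Y) I) False else 1) \<in> borel_measurable M"
    proof (cases "I \<le> n - 1")
      case True
      then show ?thesis using that unfolding right_block_eq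
        by (simp only: if_True) (rule measurable_pmf_scan_block, auto intro!: Phi)
    qed simp
    have [measurable]: "(\<lambda>Y. if 2 \<le> I then pmf (left_block R (Phi Y) I) False else 1) \<in> borel_measurable M"
    proof (cases "2 \<le> I")
      case True
      then show ?thesis using that unfolding left_block_eq
        by (simp only: if_True) (rule measurable_pmf_scan_block, auto intro!: Phi)
    qed simp
    show ?thesis unfolding iter_fail_def by measurable
  qed
  then show ?thesis unfolding fomt_pmf_def pmf_rep_pmf_False pmf_fomt_iter_False[OF n]
    by (intro borel_measurable_power borel_measurable_divide borel_measurable_sum) auto
qed

text \<open>For fixed data, failure at a good start is at most \<open>(15/16) ^ R\<close> plus twice
  the fraction \<open>b\<close> of non-rejecting pairs in the window. This bound is linear in
  \<open>b\<close>, so its expectation needs only the bound \<delta> for each pair separately,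
  whatever the dependence between pairs. The factor 4 is a 2 from the scan times a 2 from the choice
  of \<open>I\<close>.\<close>

lemma fomt_reject_lower_bound:
  assumes M: "prob_space M"
    and t: "4 \<le> t" "t \<le> real n / 4"
    and G: "G \<subseteq> {1..n}" "G \<noteq> {}"
    and Phi: "\<And>i j. i \<in> {1..n} \<Longrightarrow> j \<in> {1..n} \<Longrightarrow> Measurable.pred M (\<lambda>Y. Phi Y i j)"
    and right: "\<And>I j. I \<in> G \<Longrightarrow> j \<in> scan_window t \<Longrightarrow> real I \<le> real n / 2 \<Longrightarrow>
      measure M {Y\<in>space M. \<not> Phi Y I (I + j)} \<le> \<delta>"
    and left: "\<And>I j. I \<in> G \<Longrightarrow> j \<in> scan_window t \<Longrightarrow> real n / 2 < real I \<Longrightarrow>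
      measure M {Y\<in>space M. \<not> Phi Y (I - j) I} \<le> \<delta>"
  shows "1 - exp (- (real (card G) / real n * real m / 2))
      - 2 * (15/16) ^ nat \<lceil>20 * ln (real n)\<rceil> - 4 * \<delta>
    \<le> (\<integral>Y. pmf (fomt_pmf n m (Phi Y)) True \<partial>M)"
proof -
  interpret prob_space M by (rule M)
  define R where "R = nat \<lceil>20 * ln (real n)\<rceil>"
  define e where "e = exp (- (real (card G) / real n * real m / 2))"
  \<comment> \<open>The scan is followed to the right from the left half and to the left from the
    right half, so that the room on that side is at least \<open>t\<close>; the assumption t <= n/4
    also covers the off-by-one in \<open>I - 1\<close>.\<close>
  define psi where "psi Y I j = (if real I \<le> real n / 2 then Phi Y I (I + j) else Phi Y (I - j) I)" for Y I j
  define b where "b Y I = (\<Sum>j\<in>scan_window t. of_bool (\<not> psi Y I j)) / real (card (scan_window t))" for Y I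
  have n: "1 \<le> n" using G by auto
  have fG: "finite G" using G finite_subset by blast
  then have cG: "0 < real (card G)" using G by (simp add: card_gt_0_iff)
  have cw: "0 < real (card (scan_window t))" using card_scan_window[OF t(1)] t by linarith
  have fail: "iter_fail n R (Phi Y) I \<le> (15/16) ^ R + 2 * b Y I" if I: "I \<in> G" for Y I
  proof (cases "real I \<le> real n / 2")
    case True
    have "I \<in> {1..n}" using I G by auto
    then have "I \<le> n - 1" and N: "t \<le> real (n - I)" using True t by (auto simp: of_nat_diff)
    then show ?thesis
      using pmf_scan_block_False_le[OF t(1) N, of R "\<lambda>j. Phi Y I (I + j)"]
        iter_fail_le(3)[of I n R "Phi Y"] True
      unfolding right_block_eq b_def psi_def by simp
  next
    case False
    have "I \<in> {1..n}" using I G by auto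
    then have "2 \<le> I" and N: "t \<le> real (I - 1)" using False t by (auto simp: of_nat_diff)
    then show ?thesis
      using pmf_scan_block_False_le[OF t(1) N, of R "\<lambda>j. Phi Y (I - j) I"]
        iter_fail_le(4)[of I n R "Phi Y"] False
      unfolding left_block_eq b_def psi_def by simp
  qed
  have psi_meas [measurable]: "Measurable.pred M (\<lambda>Y. psi Y I j)"
    and psi_prob: "prob {Y\<in>space M. \<not> psi Y I j} \<le> \<delta>" if I: "I \<in> G" and j: "j \<in> scan_window t" for I j
  proof -
    have j': "real j \<le> real n / 4" "1 \<le> j" using j t by (auto simp: scan_window_def)
    have I': "I \<in> {1..n}" using I G by auto
    show "Measurable.pred M (\<lambda>Y. psi Y I j)"
    proof (cases "real I \<le> real n / 2")
      case True
      then have "I + j \<in> {1..n}" using I' j' by auto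
      then show ?thesis using Phi[OF I'] True by (simp add: psi_def)
    next
      case False
      then have "I - j \<in> {1..n}" using I' j' by auto
      then show ?thesis using Phi[OF _ I'] False by (simp add: psi_def)
    qed
    show "prob {Y\<in>space M. \<not> psi Y I j} \<le> \<delta>"
      using right[OF I j] left[OF I j] by (cases "real I \<le> real n / 2") (auto simp: psi_def)
  qed
  have one: "has_bochner_integral M (\<lambda>Y. of_bool (\<not> psi Y I j) :: real) (prob {Y\<in>space M. \<not> psi Y I j})"
    if "I \<in> G" "j \<in> scan_window t" for I j
  proof -
    have [measurable]: "Measurable.pred M (\<lambda>Y. psi Y I j)" using psi_meas that .
    have "has_bochner_integral M (indicator {Y\<in>space M. \<not> psi Y I j}) (prob {Y\<in>space M. \<not> psi Y I j})"
      by (intro has_bochner_integral_real_indicator) (auto simp: emeasure_eq_measure)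
    then show ?thesis
      by (rule has_bochner_integral_cong[THEN iffD1, rotated 3]) (auto simp: indicator_def)
  qed
  have b_int: "has_bochner_integral M (\<lambda>Y. b Y I)
      ((\<Sum>j\<in>scan_window t. prob {Y\<in>space M. \<not> psi Y I j}) / real (card (scan_window t)))" if "I \<in> G" for I
    unfolding b_def using one that
    by (intro has_bochner_integral_divide has_bochner_integral_sum) auto
  have b_le: "expectation (\<lambda>Y. b Y I) \<le> \<delta>" if "I \<in> G" for I
  proof -
    have "(\<Sum>j\<in>scan_window t. prob {Y\<in>space M. \<not> psi Y I j}) \<le> real (card (scan_window t)) * \<delta>"
      using psi_prob that by (intro sum_bounded_above) auto
    then have "(\<Sum>j\<in>scan_window t. prob {Y\<in>space M. \<not> psi Y I j}) / real (card (scan_window t)) \<le> \<delta>"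
      using cw by (simp add: field_simps)
    then show ?thesis using b_int[OF that] by (simp add: has_bochner_integral_iff)
  qed
  have b_intg: "integrable M (\<lambda>Y. b Y I)" if "I \<in> G" for I
    using b_int[OF that] by (simp add: has_bochner_integral_iff)
  have low: "1 - e - 2 * ((\<Sum>I\<in>G. (15/16) ^ R + 2 * b Y I) / real (card G))
      \<le> pmf (fomt_pmf n m (Phi Y)) True" for Y
    using pmf_fomt_pmf_False_le[OF G, of "Phi Y" "\<lambda>I. (15/16) ^ R + 2 * b Y I" m] fail[of _ Y]
      pmf_False_eq[of "fomt_pmf n m (Phi Y)"]
    unfolding e_def R_def by simp
  have "expectation (\<lambda>Y. 1 - e - 2 * ((\<Sum>I\<in>G. (15/16) ^ R + 2 * b Y I) / real (card G)))
      = 1 - e - 2 * ((\<Sum>I\<in>G. (15/16) ^ R + 2 * expectation (\<lambda>Y. b Y I)) / real (card G))"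
    using b_intg by (simp add: prob_space)
  moreover have "(\<Sum>I\<in>G. (15/16) ^ R + 2 * expectation (\<lambda>Y. b Y I)) / real (card G) \<le> (15/16) ^ R + 2 * \<delta>"
  proof -
    have "(\<Sum>I\<in>G. (15/16) ^ R + 2 * expectation (\<lambda>Y. b Y I)) \<le> real (card G) * ((15/16) ^ R + 2 * \<delta>)"
      using b_le by (intro sum_bounded_above) auto
    then show ?thesis using cG by (simp add: field_simps)
  qed
  moreover have "expectation (\<lambda>Y. 1 - e - 2 * ((\<Sum>I\<in>G. (15/16) ^ R + 2 * b Y I) / real (card G)))
      \<le> expectation (\<lambda>Y. pmf (fomt_pmf n m (Phi Y)) True)"
  proof (rule integral_mono[OF _ _ low])
    show "integrable M (\<lambda>Y. 1 - e - 2 * ((\<Sum>I\<in>G. (15/16) ^ R + 2 * b Y I) / real (card G)))"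
      using b_intg by (intro Bochner_Integration.integrable_diff integrable_mult_right integrable_divide Bochner_Integration.integrable_sum Bochner_Integration.integrable_add) auto
    have "(\<lambda>Y. 1 - pmf (fomt_pmf n m (Phi Y)) False) \<in> borel_measurable M"
      using measurable_pmf_fomt_pmf[OF Phi n] by simp
    then have "(\<lambda>Y. pmf (fomt_pmf n m (Phi Y)) True) \<in> borel_measurable M"
      by (simp add: pmf_False_eq)
    then show "integrable M (\<lambda>Y. pmf (fomt_pmf n m (Phi Y)) True)"
      by (rule integrable_const_bound[rotated, of _ 1]) (auto simp: pmf_le_1)
  qed
  ultimately show ?thesis unfolding e_def R_def by simp
qed

section \<open>Gaussian data\<close>

text \<open>On expanding the square, the mixed terms vanish because the coordinates are independent
  and centred, and each diagonal term gives the variance.\<close>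

lemma gaussian_prod_second_moment:
  fixes w \<mu> :: "'i \<Rightarrow> real"
  assumes I: "finite I" and \<sigma>: "0 < \<sigma>"
  defines "M \<equiv> PiM I (\<lambda>i. density lborel (normal_density (\<mu> i) \<sigma>))"
  shows "integrable M (\<lambda>Y. (\<Sum>i\<in>I. w i * (Y i - \<mu> i))\<^sup>2)"
    and "(\<integral>Y. (\<Sum>i\<in>I. w i * (Y i - \<mu> i))\<^sup>2 \<partial>M) = \<sigma>\<^sup>2 * (\<Sum>i\<in>I. (w i)\<^sup>2)"
proof -
  let ?N = "\<lambda>i. density lborel (normal_density (\<mu> i) \<sigma>)"
  interpret N: product_prob_space ?N I
    unfolding product_prob_space_def product_prob_space_axioms_def product_sigma_finite_def
    using prob_space_normal_density[OF \<sigma>] prob_space_imp_sigma_finite by blast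
  have pN: "prob_space (?N i)" for i using prob_space_normal_density[OF \<sigma>] .
  define g where "g i a k y = (if k = i \<and> a then y - \<mu> k else 1)" for i a k and y :: real
  have one: "(\<integral>y. 1 \<partial>?N k) = (1::real)" for k
    using prob_space.prob_space[OF pN[of k]] by simp
  have i1: "integrable (?N k) (\<lambda>y. y - \<mu> k)" "(\<integral>y. (y - \<mu> k) \<partial>?N k) = 0" for k
    using normal_moment_odd[OF \<sigma>, of "\<mu> k" 0]
    by (auto simp: integrable_real_density has_bochner_integral_iff integral_real_density normal_density_nonneg)
  have i2: "integrable (?N k) (\<lambda>y. (y - \<mu> k) * (y - \<mu> k))"
       "(\<integral>y. (y - \<mu> k) * (y - \<mu> k) \<partial>?N k) = \<sigma>\<^sup>2" for k
    using normal_moment_even[OF \<sigma>, of "\<mu> k" 1] \<sigma>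
    by (auto simp: integrable_real_density has_bochner_integral_iff integral_real_density
        normal_density_nonneg power2_eq_square)
  have ik: "integrable (?N k) (\<lambda>y. (if k = i then y - \<mu> k else 1) * (if k = j then y - \<mu> k else 1))" for i j k
    using i1(1)[of k] i2(1)[of k] by (cases "k = i"; cases "k = j") simp_all
  have P: "has_bochner_integral M (\<lambda>Y. (Y i - \<mu> i) * (Y j - \<mu> j)) (if i = j then \<sigma>\<^sup>2 else 0)"
    if ij: "i \<in> I" "j \<in> I" for i j
  proof -
    \<comment> \<open>The product of two coordinates is written as a product over all of
      \<open>I\<close> with factors 1 elsewhere, which lets the integral factor over the product
      measure; for \<open>i = j\<close> both factors sit at the same index.\<close>
    let ?f = "\<lambda>k y. (if k = i then y - \<mu> k else 1) * (if k = j then y - \<mu> k else 1)"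
    have eq: "(\<Prod>k\<in>I. ?f k (Y k)) = (Y i - \<mu> i) * (Y j - \<mu> j)" for Y
      using I ij by (simp add: prod.distrib)
    have "(\<integral>Y. (\<Prod>k\<in>I. ?f k (Y k)) \<partial>M) = (\<Prod>k\<in>I. \<integral>y. ?f k y \<partial>?N k)"
      unfolding M_def using ik I by (intro N.product_integral_prod) auto
    also have "\<dots> = (if i = j then \<sigma>\<^sup>2 else 0)"
    proof (cases "i = j")
      case True
      have "(\<Prod>k\<in>I. \<integral>y. ?f k y \<partial>?N k) = (\<Prod>k\<in>I. if k = i then \<sigma>\<^sup>2 else 1)"
        using True i2 one by (intro prod.cong) auto
      then show ?thesis using True I ij by simp
    next
      case False
      have "(\<integral>y. ?f i y \<partial>?N i) = 0" using False i1 by simp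
      then have "(\<Prod>k\<in>I. \<integral>y. ?f k y \<partial>?N k) = 0" using I ij by (intro prod_zero) blast+
      then show ?thesis using False by simp
    qed
    finally have "(\<integral>Y. (Y i - \<mu> i) * (Y j - \<mu> j) \<partial>M) = (if i = j then \<sigma>\<^sup>2 else 0)"
      unfolding eq .
    moreover have "integrable M (\<lambda>Y. \<Prod>k\<in>I. ?f k (Y k))"
      unfolding M_def using ik I by (intro N.product_integrable_prod) auto
    ultimately show ?thesis unfolding eq has_bochner_integral_iff by simp
  qed
  have sq: "(\<Sum>i\<in>I. w i * (Y i - \<mu> i))\<^sup>2
      = (\<Sum>i\<in>I. \<Sum>j\<in>I. (w i * w j) * ((Y i - \<mu> i) * (Y j - \<mu> j)))" for Y
    by (simp add: power2_eq_square sum_product mult_ac)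
  have "has_bochner_integral M (\<lambda>Y. (\<Sum>i\<in>I. w i * (Y i - \<mu> i))\<^sup>2)
      (\<Sum>i\<in>I. \<Sum>j\<in>I. (w i * w j) * (if i = j then \<sigma>\<^sup>2 else 0))"
    unfolding sq by (intro has_bochner_integral_sum has_bochner_integral_mult_right P)
  moreover have "(\<Sum>i\<in>I. \<Sum>j\<in>I. (w i * w j) * (if i = j then \<sigma>\<^sup>2 else 0)) = \<sigma>\<^sup>2 * (\<Sum>i\<in>I. (w i)\<^sup>2)"
    using I by (simp add: if_distrib sum_distrib_left power2_eq_square mult_ac cong: if_cong)
  ultimately show "integrable M (\<lambda>Y. (\<Sum>i\<in>I. w i * (Y i - \<mu> i))\<^sup>2)"
    "(\<integral>Y. (\<Sum>i\<in>I. w i * (Y i - \<mu> i))\<^sup>2 \<partial>M) = \<sigma>\<^sup>2 * (\<Sum>i\<in>I. (w i)\<^sup>2)"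
    unfolding has_bochner_integral_iff by auto
qed

lemma prob_space_data_law: "0 < \<sigma> \<Longrightarrow> prob_space (data_law \<sigma> f n)"
  unfolding data_law_def by (intro prob_space_PiM prob_space_normal_density)

lemma measurable_data_law_linear [measurable]:
  "(\<lambda>Y. \<Sum>i=1..n. w i * Y i) \<in> borel_measurable (data_law \<sigma> f n)"
proof -
  have "(\<lambda>Y. Y i) \<in> borel_measurable (data_law \<sigma> f n)" if "i \<in> {1..n}" for i
    using measurable_component_singleton[OF that, of "\<lambda>i. density lborel (normal_density (f (xpt n i)) \<sigma>)"]
    unfolding data_law_def by (simp cong: measurable_cong_sets)
  then show ?thesis by (intro borel_measurable_sum borel_measurable_times) auto
qed

text \<open>Chebyshev's inequality: the mean of the linear statistic is at least
  \<open>t + s\<close>, so a value below \<open>t\<close> deviates from the mean by at least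
  \<open>s\<close>.\<close>

lemma data_law_lower_tail:
  assumes \<sigma>: "0 < \<sigma>" and s: "0 < s"
    and gap: "t + s \<le> (\<Sum>i=1..n. w i * f (xpt n i))"
  shows "measure (data_law \<sigma> f n) {Y \<in> space (data_law \<sigma> f n). \<not> (\<Sum>i=1..n. w i * Y i) \<ge> t}
    \<le> \<sigma>\<^sup>2 * (\<Sum>i=1..n. (w i)\<^sup>2) / s\<^sup>2"
proof -
  let ?M = "data_law \<sigma> f n"
  interpret prob_space ?M by (rule prob_space_data_law[OF \<sigma>])
  have eq: "(\<Sum>i=1..n. w i * (Y i - f (xpt n i))) = (\<Sum>i=1..n. w i * Y i) - (\<Sum>i=1..n. w i * f (xpt n i))" for Y
    by (simp add: algebra_simps sum_subtractf)
  have lin: "(\<lambda>Y. \<Sum>i=1..n. w i * (Y i - f (xpt n i))) \<in> borel_measurable ?M"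
    unfolding eq by (intro borel_measurable_diff measurable_data_law_linear borel_measurable_const)
  have "measure ?M {Y \<in> space ?M. \<not> (\<Sum>i=1..n. w i * Y i) \<ge> t}
      \<le> measure ?M {Y \<in> space ?M. \<bar>\<Sum>i=1..n. w i * (Y i - f (xpt n i))\<bar> \<ge> s}"
    using gap using lin unfolding eq by (intro finite_measure_mono) (auto simp del: One_nat_def)
  also have "\<dots> \<le> expectation (\<lambda>Y. (\<Sum>i=1..n. w i * (Y i - f (xpt n i)))\<^sup>2) / s\<^sup>2"
    using gaussian_prod_second_moment(1)[of "{1..n}" \<sigma> "\<lambda>i. f (xpt n i)" w] \<sigma> s
    by (intro second_moment_method) (use lin in \<open>auto simp: data_law_def\<close>)
  also have "expectation (\<lambda>Y. (\<Sum>i=1..n. w i * (Y i - f (xpt n i)))\<^sup>2) = \<sigma>\<^sup>2 * (\<Sum>i=1..n. (w i)\<^sup>2)"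
    using gaussian_prod_second_moment(2)[of "{1..n}" \<sigma> "\<lambda>i. f (xpt n i)" w] \<sigma>
    by (simp add: data_law_def)
  finally show ?thesis .
qed

section \<open>The local linear estimator\<close>

text \<open>The indices counted are integers in [n(x - h), n(x + h)], an interval of length
  2nh.\<close>

lemma card_grid_window_le:
  assumes n: "1 \<le> n" and h: "0 \<le> h"
  shows "real (card {i\<in>{1..n}. \<bar>xpt n i - x\<bar> \<le> h}) \<le> 2 * real n * h + 1"
proof -
  define A where "A = {i\<in>{1..n}. \<bar>xpt n i - x\<bar> \<le> h}"
  define a b where "a = real n * (x - h)" and "b = real n * (x + h)"
  have ab: "b - a = 2 * real n * h" unfolding a_def b_def by (simp add: algebra_simps)
  have "0 \<le> 2 * real n * h" using h by simp
  have "int ` A \<subseteq> {\<lceil>a\<rceil>..\<lfloor>b\<rfloor>}"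
  proof
    fix k assume "k \<in> int ` A"
    then obtain i where i: "k = int i" "\<bar>real i / real n - x\<bar> \<le> h" by (auto simp: A_def xpt_def)
    have "x - h \<le> real i / real n" "real i / real n \<le> x + h" using i(2) by linarith+
    then have "a \<le> real i" "real i \<le> b" unfolding a_def b_def using n by (auto simp: field_simps)
    then show "k \<in> {\<lceil>a\<rceil>..\<lfloor>b\<rfloor>}" using i(1) by (auto simp: ceiling_le_iff le_floor_iff)
  qed
  then have "card (int ` A) \<le> card {\<lceil>a\<rceil>..\<lfloor>b\<rfloor>}" by (rule card_mono[rotated]) simp
  then have "card A \<le> nat (\<lfloor>b\<rfloor> - \<lceil>a\<rceil> + 1)" by (simp add: card_image)
  moreover have "real (nat (\<lfloor>b\<rfloor> - \<lceil>a\<rceil> + 1)) \<le> b - a + 1"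
    using ab \<open>0 \<le> 2 * real n * h\<close> by linarith
  ultimately show ?thesis using ab unfolding A_def by linarith
qed

text \<open>The eigenvalues of the 2x2 matrix are m - r and m + r, and its determinant is their
  product. As |(a - c)/2| and |b| are at most r, the numerator is at most m + 2r <= 2(m + r); the
  larger eigenvalue cancels, leaving 2/(m - r) <= 2/\<open>lam0\<close>.\<close>

lemma lpe_min_eig_bounds:
  fixes K n h x
  defines "a \<equiv> lpe_s K n h x 0" and "b \<equiv> lpe_s K n h x 1" and "c \<equiv> lpe_s K n h x 2"
  assumes lam0: "0 < lam0" "lam0 \<le> lpe_min_eig K n h x"
  shows "0 < a * c - b\<^sup>2" and "lam0 \<le> a"
    and "\<bar>u\<bar> \<le> 1 \<Longrightarrow> \<bar>(c - b * u) / (a * c - b\<^sup>2)\<bar> \<le> 2 / lam0"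
proof -
  define m r where "m = (a + c) / 2" and "r = sqrt (((a - c) / 2)\<^sup>2 + b\<^sup>2)"
  have mr: "lam0 \<le> m - r"
    using lam0(2) unfolding lpe_min_eig_def Let_def m_def r_def a_def b_def c_def .
  have r1: "\<bar>(a - c) / 2\<bar> \<le> r" and r2: "\<bar>b\<bar> \<le> r"
    unfolding r_def real_sqrt_abs[symmetric] by (intro real_sqrt_le_mono; simp)+
  have r0: "0 \<le> r" unfolding r_def by simp
  have "r\<^sup>2 = ((a - c) / 2)\<^sup>2 + b\<^sup>2" unfolding r_def by simp
  then have det: "a * c - b\<^sup>2 = (m - r) * (m + r)"
    unfolding m_def by (simp add: power2_eq_square field_simps)
  show "0 < a * c - b\<^sup>2" unfolding det using mr r0 lam0 by (intro mult_pos_pos) linarith+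
  have "m = (a + c) / 2" by (rule m_def)
  note r1' = abs_le_D1[OF r1] abs_le_D2[OF r1]
  then show "lam0 \<le> a" using \<open>m = (a + c) / 2\<close> mr r1' by (simp add: field_simps)
  assume u: "\<bar>u\<bar> \<le> 1"
  have "\<bar>b * u\<bar> \<le> r" using mult_mono[OF r2 u] r0 by (simp add: abs_mult)
  then have bu: "b * u \<le> r" "- (b * u) \<le> r" by (auto dest: abs_le_D1 abs_le_D2)
  have num: "\<bar>c - b * u\<bar> \<le> 2 * (m + r)" using bu r1' mr lam0 r0 \<open>m = (a + c) / 2\<close>
    by (intro abs_leI) (simp_all add: field_simps)
  have mr0: "0 < m + r" "0 < m - r" using mr r0 lam0 by linarith+
  have "\<bar>(c - b * u) / (a * c - b\<^sup>2)\<bar> = \<bar>c - b * u\<bar> / ((m - r) * (m + r))"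
    unfolding det using mr0 by (simp add: abs_mult)
  also have "\<dots> \<le> 2 * (m + r) / ((m - r) * (m + r))"
    using num mr0 by (intro divide_right_mono) auto
  also have "\<dots> = 2 / (m - r)"
    using mr0 by (intro mult_divide_mult_cancel_right) simp
  also have "\<dots> \<le> 2 / lam0" using mr lam0 by (intro divide_left_mono) auto
  finally show "\<bar>(c - b * u) / (a * c - b\<^sup>2)\<bar> \<le> 2 / lam0" .
qed

text \<open>Local linear fitting reproduces affine functions: the weights apply the first row of the
  inverse matrix, and the two sums reassemble the first and the second column of the matrix, giving
  1 and 0.\<close>

lemma lpe_weight_moments:
  assumes lam0: "0 < lam0" "lam0 \<le> lpe_min_eig K n h x" and h: "0 < h"
  shows "(\<Sum>i=1..n. lpe_weight K n h x i) = 1"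
    and "(\<Sum>i=1..n. lpe_weight K n h x i * (xpt n i - x)) = 0"
proof -
  define a b c where "a = lpe_s K n h x 0" and "b = lpe_s K n h x 1" and "c = lpe_s K n h x 2"
  note abc = a_def b_def c_def
  have d: "0 < a * c - b\<^sup>2" using lpe_min_eig_bounds(1)[OF lam0] unfolding abc .
  let ?u = "\<lambda>i. (xpt n i - x) / h"
  have s: "1 / (real n * h) * (\<Sum>i=1..n. ?u i ^ k * K (?u i)) = lpe_s K n h x k" for k
    unfolding lpe_s_def ..
  have W: "lpe_weight K n h x i = c / (a * c - b\<^sup>2) * ((1 / (real n * h)) * (?u i ^ 0 * K (?u i)))
      - b / (a * c - b\<^sup>2) * ((1 / (real n * h)) * (?u i ^ 1 * K (?u i)))" for i
  proof -
    have "1 / m * ((c - b * u) / q) * k = c / q * (1 / m * (u ^ 0 * k)) - b / q * (1 / m * (u ^ 1 * k))"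
      for m u q k :: real
      by (simp add: diff_divide_distrib algebra_simps)
    then show ?thesis unfolding lpe_weight_def Let_def abc[symmetric] .
  qed
  have "(\<Sum>i=1..n. lpe_weight K n h x i) = c / (a * c - b\<^sup>2) * a - b / (a * c - b\<^sup>2) * b"
    unfolding W sum_subtractf sum_distrib_left[symmetric] s abc[symmetric] ..
  also have "\<dots> = (a * c - b\<^sup>2) / (a * c - b\<^sup>2)"
  proof -
    have "c / D * a - b / D * b = (a * c - b\<^sup>2) / D" for D
      by (simp add: diff_divide_distrib power2_eq_square mult_ac)
    then show ?thesis .
  qed
  also have "\<dots> = 1" using d by simp
  finally show "(\<Sum>i=1..n. lpe_weight K n h x i) = 1" .
  have Wu: "lpe_weight K n h x i * (xpt n i - x)
      = h * (c / (a * c - b\<^sup>2) * ((1 / (real n * h)) * (?u i ^ 1 * K (?u i)))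
          - b / (a * c - b\<^sup>2) * ((1 / (real n * h)) * (?u i ^ 2 * K (?u i))))" for i
  proof -
    have gen: "(C * (m * (u ^ 0 * k)) - B * (m * (u ^ 1 * k))) * (h * u)
        = h * (C * (m * (u ^ 1 * k)) - B * (m * (u ^ 2 * k)))" for C B m u k :: real
      by (simp add: algebra_simps power2_eq_square)
    have "lpe_weight K n h x i * (xpt n i - x) = lpe_weight K n h x i * (h * ?u i)" using h by simp
    then show ?thesis unfolding W gen .
  qed
  have "(\<Sum>i=1..n. lpe_weight K n h x i * (xpt n i - x))
      = h * (c / (a * c - b\<^sup>2) * b - b / (a * c - b\<^sup>2) * c)"
    unfolding Wu sum_subtractf sum_distrib_left[symmetric] s abc[symmetric] ..
  also have "\<dots> = 0" by simp
  finally show "(\<Sum>i=1..n. lpe_weight K n h x i * (xpt n i - x)) = 0" .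
qed

text \<open>Mean value inequality for \<open>f t - f' x * t\<close> as a function of
  \<open>t\<close>, whose derivative on the segment is at most L |y - x|^(\<beta> - 1) in absolute
  value by the Hoelder condition.\<close>

lemma in_Sigma_taylor:
  assumes f: "in_Sigma \<beta> L f f'" and \<beta>: "1 < \<beta>" and L: "0 \<le> L"
    and x: "x \<in> {0..1}" and y: "y \<in> {0..1}"
  shows "\<bar>f y - f x - f' x * (y - x)\<bar> \<le> L * \<bar>y - x\<bar> powr \<beta>"
proof -
  have "norm ((f y - f' x * y) - (f x - f' x * x)) \<le> (L * \<bar>y - x\<bar> powr (\<beta> - 1)) * norm (y - x)"
  proof (rule field_differentiable_bound[where S = "closed_segment x y" and f' = "\<lambda>z. f' z - f' x"])
    fix z assume z: "z \<in> closed_segment x y"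
    then have z01: "z \<in> {0..1}" and zx: "\<bar>z - x\<bar> \<le> \<bar>y - x\<bar>"
      using x y by (auto simp: closed_segment_eq_real_ivl split: if_splits)
    have "closed_segment x y \<subseteq> {0..1}"
      using x y by (auto simp: closed_segment_eq_real_ivl split: if_splits)
    moreover have "(f has_real_derivative f' z) (at z within {0..1})"
      using f z01 unfolding in_Sigma_def by blast
    ultimately have "(f has_real_derivative f' z) (at z within closed_segment x y)"
      using DERIV_subset by blast
    then show "((\<lambda>t. f t - f' x * t) has_real_derivative f' z - f' x) (at z within closed_segment x y)"
      by (auto intro!: derivative_eq_intros)
    have "\<bar>f' z - f' x\<bar> \<le> L * \<bar>z - x\<bar> powr (\<beta> - 1)"
      using f z01 x unfolding in_Sigma_def by blast
    also have "\<dots> \<le> L * \<bar>y - x\<bar> powr (\<beta> - 1)"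
      using zx \<beta> L by (intro mult_left_mono powr_mono2) auto
    finally show "norm (f' z - f' x) \<le> L * \<bar>y - x\<bar> powr (\<beta> - 1)" by simp
  qed auto
  also have "\<dots> = L * \<bar>y - x\<bar> powr \<beta>"
    using powr_mult_base[of "\<bar>y - x\<bar>" "\<beta> - 1"] by (simp add: mult_ac)
  finally show ?thesis by (simp add: algebra_simps)
qed

text \<open>Fixes one sample size at which the eigenvalue bound holds; the asymptotic argument
  enters it for all large \<open>n\<close>. The condition n h >= 1 absorbs rounding in counts: 2nh +
  1 <= 3nh.\<close>

locale lpe_kernel =
  fixes K :: "real \<Rightarrow> real" and Kmax lam0 h :: real and n :: nat
  assumes K_nonneg: "0 \<le> K u"
    and K_upper: "K u \<le> Kmax"
    and K_supp: "1 < \<bar>u\<bar> \<Longrightarrow> K u = 0"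
    and lam0_pos: "0 < lam0"
    and lam0_eig: "x \<in> {0..1} \<Longrightarrow> lam0 \<le> lpe_min_eig K n h x"
    and h_pos: "0 < h" and nh: "1 \<le> real n * h"
begin

lemma n_pos: "1 \<le> n" using nh by (cases n) auto

lemma Kmax_nonneg: "0 \<le> Kmax" using K_nonneg[of 0] K_upper[of 0] by linarith

lemma window_card: "real (card {i\<in>{1..n}. \<bar>xpt n i - x\<bar> \<le> h}) \<le> 3 * (real n * h)"
  using card_grid_window_le[OF n_pos, of h x] h_pos nh by linarith

lemma weight_supp: "h < \<bar>xpt n i - x\<bar> \<Longrightarrow> lpe_weight K n h x i = 0"
  using K_supp[of "(xpt n i - x) / h"] h_pos by (simp add: lpe_weight_def Let_def)

lemma weight_bound:
  assumes x: "x \<in> {0..1}"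
  shows "\<bar>lpe_weight K n h x i\<bar> \<le> 2 * Kmax / lam0 / (real n * h)"
proof (cases "\<bar>xpt n i - x\<bar> \<le> h")
  case True
  let ?q = "(lpe_s K n h x 2 - lpe_s K n h x 1 * ((xpt n i - x) / h)) /
    (lpe_s K n h x 0 * lpe_s K n h x 2 - (lpe_s K n h x 1)\<^sup>2)"
  have nh0: "0 < real n * h" using nh by linarith
  have q: "\<bar>?q\<bar> \<le> 2 / lam0"
    using lpe_min_eig_bounds(3)[OF lam0_pos lam0_eig[OF x], of "(xpt n i - x) / h"] True h_pos by simp
  have "\<bar>lpe_weight K n h x i\<bar> = 1 / (real n * h) * \<bar>?q\<bar> * K ((xpt n i - x) / h)"
    unfolding lpe_weight_def Let_def using nh0 K_nonneg h_pos by (simp add: abs_mult)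
  also have "\<dots> \<le> 1 / (real n * h) * (2 / lam0) * Kmax"
    using q nh0 K_upper K_nonneg lam0_pos by (intro mult_mono mult_nonneg_nonneg) auto
  finally show ?thesis by (simp add: mult_ac)
next
  case False
  then show ?thesis using weight_supp[of i x] Kmax_nonneg lam0_pos h_pos by simp
qed

text \<open>Only the at most 3nh indices in the window contribute. It serves the variance, the bias
  and the bound on \<open>lam0\<close>.\<close>

lemma sum_window_le:
  assumes g: "\<And>i. g i \<le> (B::real)" and 0: "\<And>i. h < \<bar>xpt n i - x\<bar> \<Longrightarrow> g i = 0" and B: "0 \<le> B"
  shows "(\<Sum>i=1..n. g i) \<le> 3 * (real n * h) * B"
proof -
  have "(\<Sum>i=1..n. g i) = (\<Sum>i\<in>{i\<in>{1..n}. \<bar>xpt n i - x\<bar> \<le> h}. g i)"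
    by (intro sum.mono_neutral_right ballI) (auto intro!: 0 simp: not_le)
  also have "\<dots> \<le> real (card {i\<in>{1..n}. \<bar>xpt n i - x\<bar> \<le> h}) * B"
    using g by (intro sum_bounded_above) auto
  also have "\<dots> \<le> 3 * (real n * h) * B" using window_card B by (rule mult_right_mono)
  finally show ?thesis .
qed

lemma weight_sum_sq:
  assumes x: "x \<in> {0..1}"
  shows "(\<Sum>i=1..n. (lpe_weight K n h x i)\<^sup>2) \<le> 12 * (Kmax / lam0)\<^sup>2 / (real n * h)"
proof -
  have "(\<Sum>i=1..n. (lpe_weight K n h x i)\<^sup>2) \<le> 3 * (real n * h) * (2 * Kmax / lam0 / (real n * h))\<^sup>2"
    using weight_bound[OF x] weight_supp by (intro sum_window_le) (auto simp: abs_le_square_iff[symmetric] Kmax_nonneg lam0_pos less_imp_le[OF h_pos] less_imp_le[OF lam0_pos])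
  also have "\<dots> = 12 * (Kmax / lam0)\<^sup>2 / (real n * h)"
    using nh by (simp add: power2_eq_square field_simps)
  finally show ?thesis .
qed

text \<open>The moment identities allow the affine part of \<open>f\<close> at \<open>x\<close> to
  be subtracted. The Taylor remainder is at most L h^\<beta> on the window, and the absolute weights
  sum to at most 3nh times 2 Kmax/(lam0 n h), which is 6 Kmax/lam0. Boundary points are covered as
  well.\<close>

lemma lpe_bias:
  assumes f: "in_Sigma \<beta> L f f'" and \<beta>: "1 < \<beta>" and L: "0 \<le> L" and x: "x \<in> {0..1}"
  shows "\<bar>(\<Sum>i=1..n. lpe_weight K n h x i * f (xpt n i)) - f x\<bar> \<le> 6 * Kmax / lam0 * L * h powr \<beta>"
proof -
  let ?w = "lpe_weight K n h x"
  note m = lpe_weight_moments[OF lam0_pos lam0_eig[OF x] h_pos]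
  have nh0: "0 < real n * h" using nh by linarith
  have "(\<Sum>i=1..n. ?w i * f (xpt n i)) - f x
      = (\<Sum>i=1..n. ?w i * f (xpt n i)) - f x * (\<Sum>i=1..n. ?w i) - f' x * (\<Sum>i=1..n. ?w i * (xpt n i - x))"
    unfolding m by simp
  also have "\<dots> = (\<Sum>i=1..n. ?w i * (f (xpt n i) - f x - f' x * (xpt n i - x)))"
    by (simp add: sum_distrib_left flip: sum_subtractf) (simp add: algebra_simps)
  finally have "\<bar>(\<Sum>i=1..n. ?w i * f (xpt n i)) - f x\<bar>
      \<le> (\<Sum>i=1..n. \<bar>?w i * (f (xpt n i) - f x - f' x * (xpt n i - x))\<bar>)"
    by (simp only: sum_abs)
  also have "\<dots> \<le> (\<Sum>i=1..n. \<bar>?w i\<bar> * (L * h powr \<beta>))"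
  proof (rule sum_mono)
    fix i assume i: "i \<in> {1..n}"
    show "\<bar>?w i * (f (xpt n i) - f x - f' x * (xpt n i - x))\<bar> \<le> \<bar>?w i\<bar> * (L * h powr \<beta>)"
    proof (cases "\<bar>xpt n i - x\<bar> \<le> h")
      case True
      have "xpt n i \<in> {0..1}" using i by (auto simp: xpt_def)
      then have "\<bar>f (xpt n i) - f x - f' x * (xpt n i - x)\<bar> \<le> L * \<bar>xpt n i - x\<bar> powr \<beta>"
        using in_Sigma_taylor[OF f \<beta> L x] by blast
      also have "\<dots> \<le> L * h powr \<beta>" using True \<beta> L by (intro mult_left_mono powr_mono2) auto
      finally show ?thesis by (simp add: abs_mult mult_left_mono)
    qed (use weight_supp in simp)
  qed
  also have "\<dots> = (\<Sum>i=1..n. \<bar>?w i\<bar>) * (L * h powr \<beta>)" by (simp add: sum_distrib_right)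
  also have "\<dots> \<le> 3 * (real n * h) * (2 * Kmax / lam0 / (real n * h)) * (L * h powr \<beta>)"
    using weight_bound[OF x] weight_supp L Kmax_nonneg lam0_pos nh0
    by (intro mult_right_mono sum_window_le) auto
  also have "\<dots> = 6 * Kmax / lam0 * L * h powr \<beta>" using n_pos h_pos by simp
  finally show ?thesis .
qed

text \<open>At x = 0 the upper left entry of the matrix lies between \<open>lam0\<close> and
  \<open>3 * Kmax\<close>. The bound serves to absorb terms without the factor Kmax/lam0 into terms
  with it.\<close>

lemma lam0_le: "lam0 \<le> 3 * Kmax"
proof -
  have nh0: "0 < real n * h" using nh by linarith
  have "lam0 \<le> lpe_s K n h 0 0" using lpe_min_eig_bounds(2)[OF lam0_pos lam0_eig[of 0]] by simp
  also have "\<dots> = 1 / (real n * h) * (\<Sum>i=1..n. K ((xpt n i - 0) / h))" by (simp add: lpe_s_def)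
  also have "\<dots> \<le> 1 / (real n * h) * (3 * (real n * h) * Kmax)"
    using K_upper Kmax_nonneg nh0 h_pos K_supp by (intro mult_left_mono sum_window_le[of _ _ 0]) auto
  also have "\<dots> = 3 * Kmax" using n_pos h_pos by simp
  finally show ?thesis .
qed

text \<open>From (a - b)^2 <= 2a^2 + 2b^2. Cancellation between the two weights is ignored, which
  costs only a constant for pairs at a distance of order h.\<close>

lemma weight_diff_sum_sq:
  assumes x: "x \<in> {0..1}" and y: "y \<in> {0..1}"
  shows "(\<Sum>i=1..n. (lpe_weight K n h x i - lpe_weight K n h y i)\<^sup>2) \<le> 48 * (Kmax / lam0)\<^sup>2 / (real n * h)"
proof -
  have "(\<Sum>i=1..n. (lpe_weight K n h x i - lpe_weight K n h y i)\<^sup>2)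
      \<le> (\<Sum>i=1..n. 2 * (lpe_weight K n h x i)\<^sup>2 + 2 * (lpe_weight K n h y i)\<^sup>2)"
  proof (rule sum_mono)
    fix i
    show "(lpe_weight K n h x i - lpe_weight K n h y i)\<^sup>2
        \<le> 2 * (lpe_weight K n h x i)\<^sup>2 + 2 * (lpe_weight K n h y i)\<^sup>2"
      using sum_squares_ge_zero[of "lpe_weight K n h x i + lpe_weight K n h y i" 0]
      by (simp add: power2_eq_square algebra_simps)
  qed
  also have "\<dots> \<le> 2 * (12 * (Kmax / lam0)\<^sup>2 / (real n * h)) + 2 * (12 * (Kmax / lam0)\<^sup>2 / (real n * h))"
    using weight_sum_sq[OF x] weight_sum_sq[OF y] unfolding sum.distrib sum_distrib_left[symmetric]
    by (intro add_mono mult_left_mono) auto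
  finally show ?thesis by (simp add: mult_ac)
qed

end

section \<open>Grid points, constants and bandwidth\<close>

text \<open>Every z > 0 in the set lies in [x_i - 1/n, x_i] for i the ceiling of n z, so the
  intervals of length 1/n attached to the counted indices cover the set.\<close>

lemma eps1_le_grid_fraction:
  assumes n: "1 \<le> n" and pos: "0 < eps1 \<gamma> f'"
  shows "eps1 \<gamma> f' \<le>
    real (card {i\<in>{1..n}. \<exists>z\<in>Dset \<gamma> f'. \<bar>z - xpt n i\<bar> \<le> 1 / real n}) / real n"
proof -
  let ?G = "{i\<in>{1..n}. \<exists>z\<in>Dset \<gamma> f'. \<bar>z - xpt n i\<bar> \<le> 1 / real n}"
  let ?J = "\<lambda>i. {xpt n i - 1 / real n..xpt n i}"
  \<comment> \<open>A set that is not measurable would have \<open>measure\<close> 0, so positivity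
    yields measurability.\<close>
  have meas: "Dset \<gamma> f' \<in> sets lebesgue"
    using pos measure_notin_sets unfolding eps1_def by force
  have "Dset \<gamma> f' \<subseteq> (\<Union>i\<in>?G. ?J i)"
  proof
    fix z assume z: "z \<in> Dset \<gamma> f'"
    then have z01: "0 \<le> z" "z \<le> 1" by (auto simp: Dset_def)
    \<comment> \<open>The maximum with 1 covers z = 0, whose ceiling would give the index 0 outside
      the grid.\<close>
    define i where "i = max 1 (nat \<lceil>real n * z\<rceil>)"
    have nz: "0 \<le> real n * z" "real n * z \<le> real n" using z01 by (auto simp: mult_left_le)
    have i: "i \<in> {1..n}" unfolding i_def using nz n by (auto simp: nat_le_iff ceiling_le_iff)
    have "real n * z \<le> real i" "real i \<le> real n * z + 1" unfolding i_def using nz by linarith+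
    then have "z \<le> xpt n i" "xpt n i - 1 / real n \<le> z"
      using n by (auto simp: xpt_def field_simps)
    moreover from this have "\<bar>z - xpt n i\<bar> \<le> 1 / real n" by linarith
    then have "i \<in> ?G" using i z by blast
    ultimately show "z \<in> (\<Union>i\<in>?G. ?J i)" by auto
  qed
  then have "measure lebesgue (Dset \<gamma> f') \<le> measure lebesgue (\<Union>i\<in>?G. ?J i)"
    using meas by (intro measure_mono_fmeasurable fmeasurable.finite_UN) auto
  also have "\<dots> \<le> (\<Sum>i\<in>?G. measure lebesgue (?J i))" by (rule measure_UNION_le) auto
  also have "\<dots> = real (card ?G) / real n" by simp
  finally show ?thesis unfolding eps1_def .
qed

text \<open>\<open>K\<close> lives on [-1,1], is at most \<open>Kmax\<close> and has mass 1, so 2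
  Kmax >= 1. Integrating K^2 <= Kmax K bounds \<open>mu2 K\<close> above, and the lower bound
  \<open>Kmin\<close> on [-\<Delta>, \<Delta>] makes it positive.\<close>

lemma kernel_constants:
  fixes K :: "real \<Rightarrow> real"
  assumes K_nonneg: "\<forall>u. 0 \<le> K u"
    and K_int: "(K has_integral 1) UNIV"
    and K_supp: "\<forall>u. 1 < \<bar>u\<bar> \<longrightarrow> K u = 0"
    and K_consts: "0 < Kmin" "0 < \<Delta>"
    and K_lower: "\<forall>u. \<bar>u\<bar> \<le> \<Delta> \<longrightarrow> Kmin \<le> K u"
    and K_upper: "\<forall>u. K u \<le> Kmax"
    and K_lip: "\<forall>u v. \<bar>K u - K v\<bar> \<le> LK * \<bar>u - v\<bar>"
  shows "1 / 2 \<le> Kmax" "0 < mu2 K" "mu2 K \<le> Kmax"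
proof -
  have Kmax0: "0 \<le> Kmax" using K_nonneg K_upper order_trans by blast
  have "((\<lambda>u::real. if u \<in> cbox (-1) 1 then Kmax else 0) has_integral 2 * Kmax) UNIV"
    unfolding has_integral_restrict_UNIV using has_integral_const_real[of Kmax "-1" 1]
    by (simp add: cbox_interval)
  then have "1 \<le> 2 * Kmax"
    using K_supp K_upper by (intro has_integral_le[OF K_int]) (auto simp: not_le[symmetric] abs_le_iff)
  then show "1 / 2 \<le> Kmax" by simp
  have "LK-lipschitz_on UNIV K"
  proof (rule lipschitz_onI)
    show "0 \<le> LK" using K_lip[rule_format, of 0 1] by simp
  qed (use K_lip in \<open>auto simp: dist_real_def\<close>)
  then have cont: "continuous_on S K" for S
    using lipschitz_on_continuous_on continuous_on_subset by blast
  have "(\<lambda>u. (K u)\<^sup>2) integrable_on cbox (-1) 1"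
    by (intro integrable_continuous continuous_intros cont)
  then have int2: "(\<lambda>u. (K u)\<^sup>2) integrable_on UNIV"
    by (rule integrable_on_superset) (use K_supp in \<open>auto simp: not_le[symmetric] abs_le_iff\<close>)
  have "integral UNIV (\<lambda>u. (K u)\<^sup>2) \<le> integral UNIV (\<lambda>u. Kmax * K u)"
  proof (rule integral_le[OF int2])
    show "(\<lambda>u. Kmax * K u) integrable_on UNIV"
      using K_int by (intro integrable_on_mult_right) blast
    show "(K u)\<^sup>2 \<le> Kmax * K u" for u
      using K_upper K_nonneg by (simp add: power2_eq_square mult_right_mono)
  qed
  also have "\<dots> = Kmax" using K_int by (simp add: integral_unique)
  finally show "mu2 K \<le> Kmax" unfolding mu2_def .
  have "0 < 2 * \<Delta> * Kmin\<^sup>2" using K_consts by simp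
  also have "2 * \<Delta> * Kmin\<^sup>2 = integral (cbox (-\<Delta>) \<Delta>) (\<lambda>u. Kmin\<^sup>2)"
    using K_consts by simp
  also have "\<dots> \<le> integral (cbox (-\<Delta>) \<Delta>) (\<lambda>u. (K u)\<^sup>2)"
  proof (rule integral_le)
    show "(\<lambda>u. (K u)\<^sup>2) integrable_on cbox (-\<Delta>) \<Delta>"
      by (intro integrable_continuous continuous_intros cont)
    show "Kmin\<^sup>2 \<le> (K u)\<^sup>2" if "u \<in> cbox (-\<Delta>) \<Delta>" for u
      using that K_lower K_consts by (intro power_mono) (auto simp: abs_le_iff)
  qed auto
  also have "\<dots> \<le> integral UNIV (\<lambda>u. (K u)\<^sup>2)"
    by (intro integral_subset_le int2 integrable_continuous continuous_intros cont) auto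
  finally show "0 < mu2 K" unfolding mu2_def .
qed

text \<open>Half of \<open>C\<^sub>\<beta> - 4L\<close>: the threshold \<open>C\<^sub>n\<^sub>,\<^sub>\<alpha>\<^sub>,\<^sub>i\<^sub>,\<^sub>j\<close> is at most this times \<open>h\<^sup>\<beta>\<^sup>-\<^sup>1 \<bar>x\<^sub>i - x\<^sub>j\<bar>\<close>, and as much again is left for the noise.\<close>
definition noise_slope :: "real \<Rightarrow> real \<Rightarrow> real \<Rightarrow> (real \<Rightarrow> real) \<Rightarrow> real \<Rightarrow> real \<Rightarrow> real \<Rightarrow> real" where
  "noise_slope \<beta> L \<sigma> K Kmax LK lam0 = 8 * L2c Kmax LK * \<sigma> / lam0 *
       sqrt (4 * Wc Kmax LK lam0 / Ch \<beta> L \<sigma> K Kmax lam0 powr (2 * \<beta> + 1))"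

lemma Cbeta_eq: "Cbeta \<beta> L \<sigma> K Kmax LK lam0 = 4 * L + 2 * noise_slope \<beta> L \<sigma> K Kmax LK lam0"
  unfolding Cbeta_def noise_slope_def by simp

text \<open>Inserting the definition of \<open>Ch\<close> cancels \<sigma> and shows that the slope
  is at least 2048 L (Kmax/lam0)^2, which dominates because Kmax/lam0 >= 1/3. On the left, 28 = 12 +
  16 collects the bias of two estimates and the boundary threshold, 2 comes from the maximum in that
  threshold, and the factor 4 makes them fit into a quarter of the slope.\<close>

lemma noise_slope_ge:
  assumes \<beta>: "1 < \<beta>" and L: "0 < L" and \<sigma>: "0 < \<sigma>" and lam0: "0 < lam0" "lam0 \<le> 3 * Kmax"
    and Kmax: "1 / 2 \<le> Kmax" and mu2: "0 < mu2 K" "mu2 K \<le> Kmax" and LK: "0 \<le> LK"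
  shows "4 * (28 * Kmax / lam0 + 2) * L \<le> noise_slope \<beta> L \<sigma> K Kmax LK lam0"
proof -
  have K0: "0 < Kmax" using Kmax by linarith
  define X where "X = (32 * \<sigma>\<^sup>2 * mu2 K / lam0\<^sup>2) / (4 * (Cstar Kmax lam0 * L)\<^sup>2 * \<beta>)"
  have Cs: "0 < Cstar Kmax lam0" using K0 lam0 by (simp add: Cstar_def)
  have X0: "0 < X" unfolding X_def using \<sigma> mu2 lam0 Cs L \<beta> by (intro divide_pos_pos mult_pos_pos) auto
  have Ch: "Ch \<beta> L \<sigma> K Kmax lam0 = X powr (1 / (2 * \<beta> + 1))"
    unfolding Ch_def Let_def X_def ..
  have ChX: "Ch \<beta> L \<sigma> K Kmax lam0 powr (2 * \<beta> + 1) = X"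
    unfolding Ch using X0 \<beta> by (simp add: powr_powr)
  \<comment> \<open>The constant 64 is the one for which, after mu2 <= Kmax <= 2 Kmax^2, the bound
    becomes exactly 16 times the square of \<open>Cstar\<close>, one of the two entries in 4 times
    \<open>Wc\<close>.\<close>
  have eq: "(64 * Kmax * L / (lam0 * \<sigma>))\<^sup>2 * X = 512 * mu2 K / (\<beta> * lam0\<^sup>2)"
    unfolding X_def Cstar_def using \<sigma> lam0 K0 L \<beta> by (simp add: power2_eq_square field_simps)
  have "(64 * Kmax * L / (lam0 * \<sigma>))\<^sup>2 * X \<le> 512 * mu2 K / lam0\<^sup>2 * 1"
  proof -
    have "512 * mu2 K / (\<beta> * lam0\<^sup>2) = 512 * mu2 K / lam0\<^sup>2 * (1 / \<beta>)" by simp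
    also have "\<dots> \<le> 512 * mu2 K / lam0\<^sup>2 * 1" using \<beta> mu2 by (intro mult_left_mono) auto
    finally show ?thesis unfolding eq .
  qed
  also have "\<dots> \<le> 4 * (4 * (Cstar Kmax lam0)\<^sup>2)"
  proof -
    have "mu2 K \<le> 2 * Kmax * Kmax" using Kmax mu2 K0 mult_right_mono[of 1 "2 * Kmax" Kmax] by linarith
    then have "512 * mu2 K / lam0\<^sup>2 \<le> 512 * (2 * Kmax * Kmax) / lam0\<^sup>2"
      by (intro divide_right_mono) auto
    also have "\<dots> \<le> 4 * (4 * (Cstar Kmax lam0)\<^sup>2)"
      unfolding Cstar_def using K0 lam0 by (simp add: power2_eq_square field_simps)
    finally show ?thesis by simp
  qed
  also have "\<dots> \<le> 4 * Wc Kmax LK lam0" unfolding Wc_def by simp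
  finally have "(64 * Kmax * L / (lam0 * \<sigma>))\<^sup>2 \<le> 4 * Wc Kmax LK lam0 / X"
    using X0 by (simp add: field_simps)
  then have s: "64 * Kmax * L / (lam0 * \<sigma>) \<le> sqrt (4 * Wc Kmax LK lam0 / X)"
    by (rule real_le_rsqrt)
  have "1 / 3 \<le> Kmax / lam0" using lam0 by (simp add: field_simps)
  then have r: "2048 * (Kmax / lam0) * L * (1/3) \<le> 2048 * (Kmax / lam0) * L * (Kmax / lam0)"
    "2 * L \<le> 6 * (Kmax / lam0) * L"
    using L K0 lam0 by (intro mult_left_mono mult_right_mono mult_nonneg_nonneg; simp add: field_simps)+
  have "4 * (28 * Kmax / lam0 + 2) * L = 112 * (Kmax / lam0) * L + 4 * (2 * L)"
    by (simp add: algebra_simps)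
  also have "\<dots> \<le> 2048 * (Kmax / lam0) * L * (1/3)"
  proof -
    define x where "x = Kmax / lam0 * L"
    have "0 \<le> x" "2 * L \<le> 6 * x" using r(2) K0 lam0 L by (simp_all add: x_def)
    then have "112 * x + 4 * (2 * L) \<le> 2048 * x * (1/3)" by linarith
    then show ?thesis unfolding x_def mult.assoc .
  qed
  also have "\<dots> \<le> 2048 * (Kmax / lam0) * L * (Kmax / lam0)" by (rule r(1))
  also have "\<dots> = 8 * (4 * Kmax) * \<sigma> / lam0 * (64 * Kmax * L / (lam0 * \<sigma>))"
    using \<sigma> by simp
  also have "\<dots> \<le> 8 * L2c Kmax LK * \<sigma> / lam0 * sqrt (4 * Wc Kmax LK lam0 / X)"
    using s K0 L \<sigma> lam0 LK
    by (intro mult_mono divide_right_mono mult_right_mono) (auto simp: L2c_def)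
  finally show "4 * (28 * Kmax / lam0 + 2) * L \<le> noise_slope \<beta> L \<sigma> K Kmax LK lam0"
    unfolding noise_slope_def ChX .
qed

text \<open>This identity trades log n for powers of n and h, both in the threshold and in the
  variance bound.\<close>

lemma bw_power:
  assumes "0 < Ch \<beta> L \<sigma> K Kmax lam0" "1 < \<beta>" "2 \<le> n"
  shows "real n * bw \<beta> L \<sigma> K Kmax lam0 n powr (2 * \<beta> + 1)
    = Ch \<beta> L \<sigma> K Kmax lam0 powr (2 * \<beta> + 1) * ln (real n)"
  using assms by (simp add: bw_def powr_mult powr_powr)

text \<open>By \<open>bw_power\<close>, log n is n h^(2\<beta> + 1) divided by a constant. After
  taking the root the powers of n cancel and those of h combine to \<beta> + 1/2 - 3/2 = \<beta> -
  1; the minimum is bounded by its first argument.\<close>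

lemma pair_threshold_le:
  assumes Ch: "0 < Ch \<beta> L \<sigma> K Kmax lam0" and \<beta>: "1 < \<beta>" and n: "2 \<le> n"
    and h: "h = bw \<beta> L \<sigma> K Kmax lam0 n"
    and lnle: "- 2 * ln (\<alpha> / Nmax) \<le> 4 * ln (real n)"
    and \<sigma>: "0 < \<sigma>" and lam0: "0 < lam0" and L2: "0 \<le> L2c Kmax LK" and d: "0 \<le> d"
  shows "\<sigma> * sqrt (- 2 * ln (\<alpha> / Nmax) * Wc Kmax LK lam0) * real n powr (-1/2) * h powr (-3/2)
      * min (8 * L2c Kmax LK / lam0 * d) h
    \<le> noise_slope \<beta> L \<sigma> K Kmax LK lam0 * h powr (\<beta> - 1) * d"
proof -
  let ?W = "Wc Kmax LK lam0" and ?X = "Ch \<beta> L \<sigma> K Kmax lam0 powr (2 * \<beta> + 1)"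
  have X0: "0 < ?X" using Ch by simp
  have h0: "0 < h" unfolding h bw_def using Ch n by simp
  have n0: "0 < real n" using n by simp
  have W0: "0 \<le> ?W" by (simp add: Wc_def le_max_iff_disj)
  have "sqrt (- 2 * ln (\<alpha> / Nmax) * ?W) \<le> sqrt (4 * ln (real n) * ?W)"
    by (intro real_sqrt_le_mono mult_right_mono lnle W0)
  also have "4 * ln (real n) * ?W = 4 * ?W / ?X * (real n * h powr (2 * \<beta> + 1))"
    unfolding h bw_power[OF Ch \<beta> n] using X0 by simp
  also have "sqrt \<dots> = sqrt (4 * ?W / ?X) * (real n powr (1/2) * h powr (\<beta> + 1/2))"
  proof -
    have "sqrt (h powr (2 * \<beta> + 1)) = h powr (\<beta> + 1/2)"
      using h0 by (simp add: powr_half_sqrt[symmetric] powr_powr field_simps)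
    then show ?thesis using n0 by (simp only: real_sqrt_mult powr_half_sqrt less_imp_le)
  qed
  finally have s: "sqrt (- 2 * ln (\<alpha> / Nmax) * ?W)
      \<le> sqrt (4 * ?W / ?X) * (real n powr (1/2) * h powr (\<beta> + 1/2))" .
  have "\<sigma> * sqrt (- 2 * ln (\<alpha> / Nmax) * ?W) * real n powr (-1/2) * h powr (-3/2)
      * min (8 * L2c Kmax LK / lam0 * d) h
    \<le> \<sigma> * (sqrt (4 * ?W / ?X) * (real n powr (1/2) * h powr (\<beta> + 1/2))) * real n powr (-1/2) * h powr (-3/2)
      * (8 * L2c Kmax LK / lam0 * d)"
  proof (rule mult_mono)
    show "\<sigma> * sqrt (- 2 * ln (\<alpha> / Nmax) * ?W) * real n powr (-1/2) * h powr (-3/2)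
      \<le> \<sigma> * (sqrt (4 * ?W / ?X) * (real n powr (1/2) * h powr (\<beta> + 1/2))) * real n powr (-1/2) * h powr (-3/2)"
      using s \<sigma> by (intro mult_right_mono mult_left_mono) auto
    show "0 \<le> \<sigma> * (sqrt (4 * ?W / ?X) * (real n powr (1/2) * h powr (\<beta> + 1/2))) * real n powr (-1/2) * h powr (-3/2)"
      using \<sigma> W0 X0 by (intro mult_nonneg_nonneg) auto
    show "0 \<le> min (8 * L2c Kmax LK / lam0 * d) h" using L2 lam0 d h0 by auto
  qed simp
  also have "\<dots> = \<sigma> * sqrt (4 * ?W / ?X) * (8 * L2c Kmax LK / lam0 * d)
      * (real n powr (1/2) * real n powr (-1/2)) * (h powr (\<beta> + 1/2) * h powr (-3/2))"
    by (simp only: mult_ac)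
  also have "real n powr (1/2) * real n powr (-1/2) = 1"
    using n0 by (simp flip: powr_add)
  also have "h powr (\<beta> + 1/2) * h powr (-3/2) = h powr (\<beta> - 1)"
    by (simp flip: powr_add)
  finally show ?thesis unfolding noise_slope_def by (simp add: mult_ac)
qed

section \<open>Power of a single local test\<close>

lemma in_Sigma_decrease:
  assumes f: "in_Sigma \<beta> L f f'" and xy: "0 \<le> x" "x < y" "y \<le> 1"
    and slope: "\<And>z. x \<le> z \<Longrightarrow> z \<le> y \<Longrightarrow> f' z \<le> - g"
  shows "g * (y - x) \<le> f x - f y"
proof -
  have "\<exists>z\<in>{x<..<y}. f y - f x = f' z * (y - x)"
  proof (rule mvt_simple[OF xy(2)])
    fix z assume z: "x \<le> z" "z \<le> y"
    then have "(f has_real_derivative f' z) (at z within {0..1})"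
      using f xy unfolding in_Sigma_def by auto
    then have "(f has_real_derivative f' z) (at z within {x..y})"
      by (rule DERIV_subset) (use xy in auto)
    then show "(f has_derivative (*) (f' z)) (at z within {x..y})"
      by (simp add: has_field_derivative_def)
  qed
  then obtain z where z: "x < z" "z < y" "f y - f x = f' z * (y - x)" by auto
  have "f' z * (y - x) \<le> - g * (y - x)" using slope[of z] z xy by (intro mult_right_mono) auto
  then show ?thesis using z(3) by linarith
qed

text \<open>The drop of \<open>f\<close> is at least (2A + 2L) h^(\<beta> - 1) (y - x). One A pays
  for \<open>C\<close>; the rest is at least (A/2 + L) h^\<beta>, since y - x >= h/2. Bias and
  \<open>D\<close> together cost at most (A/4) h^\<beta>, so a margin (A/4) h^\<beta> remains for
  Chebyshev's inequality, where 768 = 48 * 16.\<close>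

lemma (in lpe_kernel) pair_accept_prob_le:
  assumes f: "in_Sigma \<beta> L f f'" and \<beta>: "1 < \<beta>" and L: "0 < L" and \<sigma>: "0 < \<sigma>"
    and A: "4 * (28 * Kmax / lam0 + 2) * L \<le> A"
    and x: "x \<in> {0..1}" and y: "y \<in> {0..1}" and d: "h / 2 \<le> y - x"
    and slope: "\<And>z. x \<le> z \<Longrightarrow> z \<le> y \<Longrightarrow> f' z \<le> - ((2 * A + 2 * L) * h powr (\<beta> - 1))"
    and C: "C \<le> A * h powr (\<beta> - 1) * (y - x)"
    and D: "D \<le> max (16 * Kmax / lam0) 2 * L * h powr \<beta>"
  shows "measure (data_law \<sigma> f n) {Y\<in>space (data_law \<sigma> f n). \<not> lpe K n h Y x - lpe K n h Y y \<ge> C + D}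
    \<le> 768 * \<sigma>\<^sup>2 * (Kmax / lam0)\<^sup>2 / A\<^sup>2 / (real n * h powr (2 * \<beta> + 1))"
proof -
  define w where "w i = lpe_weight K n h x i - lpe_weight K n h y i" for i
  define H where "H = h powr \<beta>"
  define \<rho> where "\<rho> = Kmax / lam0"
  have H0: "0 < H" using h_pos by (simp add: H_def)
  have \<rho>0: "0 \<le> \<rho>" using Kmax_nonneg lam0_pos by (simp add: \<rho>_def)
  have A': "4 * (28 * \<rho> + 2) * L \<le> A" using A by (simp add: \<rho>_def)
  have "0 < 4 * (28 * \<rho> + 2) * L" using \<rho>0 L by (intro mult_pos_pos) auto
  then have A0: "0 < A" using A' by linarith
  have xy: "x < y" using d h_pos by linarith
  have Hh: "h powr (\<beta> - 1) * h = H"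
    using powr_mult_base[of h "\<beta> - 1"] h_pos by (simp add: H_def mult_ac)
  have lin: "lpe K n h Y x - lpe K n h Y y = (\<Sum>i=1..n. w i * Y i)" for Y
    unfolding lpe_def w_def by (simp add: sum_subtractf[symmetric] left_diff_distrib)
  have dec: "(2 * A + 2 * L) * h powr (\<beta> - 1) * (y - x) \<le> f x - f y"
    using x y xy slope by (intro in_Sigma_decrease[OF f]) auto
  have "\<bar>(\<Sum>i=1..n. lpe_weight K n h x i * f (xpt n i)) - f x\<bar> \<le> 6 * \<rho> * L * H"
    "\<bar>(\<Sum>i=1..n. lpe_weight K n h y i * f (xpt n i)) - f y\<bar> \<le> 6 * \<rho> * L * H"
    using lpe_bias[OF f \<beta> less_imp_le[OF L] x] lpe_bias[OF f \<beta> less_imp_le[OF L] y]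
    by (simp_all add: \<rho>_def H_def)
  moreover have "(\<Sum>i=1..n. w i * f (xpt n i)) = (\<Sum>i=1..n. lpe_weight K n h x i * f (xpt n i))
      - (\<Sum>i=1..n. lpe_weight K n h y i * f (xpt n i))"
    unfolding w_def by (simp add: sum_subtractf[symmetric] left_diff_distrib)
  ultimately have bias: "f x - f y - 12 * \<rho> * L * H \<le> (\<Sum>i=1..n. w i * f (xpt n i))"
    by linarith
  have half: "(A + 2 * L) * H / 2 \<le> (A + 2 * L) * h powr (\<beta> - 1) * (y - x)"
  proof -
    have "(A + 2 * L) * h powr (\<beta> - 1) * (h / 2) \<le> (A + 2 * L) * h powr (\<beta> - 1) * (y - x)"
      using d A0 L by (intro mult_left_mono) auto
    then show ?thesis using Hh by (simp add: mult.assoc)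
  qed
  have D': "D \<le> (16 * \<rho> + 2) * L * H"
  proof -
    have "max (16 * Kmax / lam0) 2 * L * H \<le> (16 * \<rho> + 2) * L * H"
      using \<rho>0 L H0 by (intro mult_right_mono) (auto simp: \<rho>_def)
    then show ?thesis using D by (simp add: H_def)
  qed
  have AH: "(28 * \<rho> + 2) * L * H \<le> A / 4 * H"
  proof (rule mult_right_mono)
    show "(28 * \<rho> + 2) * L \<le> A / 4" using A' by (simp add: algebra_simps)
  qed (use H0 in simp)
  have LH: "0 < L * H" using L H0 by simp
  have "C + D + A / 4 * H \<le> f x - f y - 12 * \<rho> * L * H"
  proof -
    \<comment> \<open>With A P, L P, A H, \<rho> L H and L H as unknowns the whole budget is linear
      arithmetic.\<close>
    define P where "P = h powr (\<beta> - 1) * (y - x)"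
    have "2 * (A * P) + 2 * (L * P) \<le> f x - f y" "C \<le> A * P"
      "A * H / 2 + L * H \<le> A * P + 2 * (L * P)"
      using dec C half by (simp_all add: P_def ring_distribs add_divide_distrib mult.assoc)
    moreover have "D \<le> 16 * (\<rho> * L * H) + 2 * (L * H)" "28 * (\<rho> * L * H) + 2 * (L * H) \<le> A * H / 4"
      using D' AH by (simp_all add: ring_distribs mult.assoc)
    ultimately show ?thesis using LH by simp
  qed
  then have gap: "(C + D) + A / 4 * H \<le> (\<Sum>i=1..n. w i * f (xpt n i))"
    using bias by linarith
  have s: "0 < A / 4 * H" using A0 H0 by simp
  have nh0: "0 < real n * h" using nh by linarith
  have "measure (data_law \<sigma> f n) {Y\<in>space (data_law \<sigma> f n). \<not> lpe K n h Y x - lpe K n h Y y \<ge> C + D}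
      \<le> \<sigma>\<^sup>2 * (\<Sum>i=1..n. (w i)\<^sup>2) / (A / 4 * H)\<^sup>2"
    unfolding lin by (rule data_law_lower_tail[OF \<sigma> s gap])
  also have "\<dots> \<le> \<sigma>\<^sup>2 * (48 * \<rho>\<^sup>2 / (real n * h)) / (A / 4 * H)\<^sup>2"
    using weight_diff_sum_sq[OF x y] unfolding w_def \<rho>_def
    by (intro divide_right_mono mult_left_mono) auto
  also have "\<dots> = 768 * \<sigma>\<^sup>2 * \<rho>\<^sup>2 / A\<^sup>2 / (real n * (h * H\<^sup>2))"
    by (simp add: power_mult_distrib power_divide field_simps)
  also have "h * H\<^sup>2 = h powr (2 * \<beta> + 1)"
  proof -
    have "H\<^sup>2 = h powr (2 * \<beta>)" using h_pos by (simp add: H_def power2_eq_square flip: powr_add)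
    then show ?thesis using powr_mult_base[of h "2 * \<beta>"] h_pos by (simp add: add.commute)
  qed
  finally show ?thesis unfolding \<rho>_def .
qed

text \<open>The points \<open>y\<close> and \<open>z\<close> are at most h + 1/n <= 2h apart, and
  2^(\<beta> - 1) <= 2 because \<beta> \<le> 2, so the Hoelder condition changes the derivative by
  at most 2L h^(\<beta> - 1).\<close>

lemma slope_near_Dset:
  assumes f: "in_Sigma \<beta> L f f'" and \<beta>: "1 < \<beta>" "\<beta> \<le> 2" and L: "0 < L" and h: "0 < h" "1 / real n \<le> h"
    and z: "z \<in> Dset (g * h powr (\<beta> - 1)) f'" "\<bar>z - x\<bar> \<le> 1 / real n"
    and y: "y \<in> {0..1}" "\<bar>y - x\<bar> \<le> h"
  shows "f' y \<le> - ((g - 2 * L) * h powr (\<beta> - 1))"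
proof -
  have z01: "z \<in> {0..1}" and fz: "f' z \<le> - (g * h powr (\<beta> - 1))" using z by (auto simp: Dset_def)
  have "\<bar>y - z\<bar> \<le> 2 * h" using z y h by linarith
  then have "\<bar>y - z\<bar> powr (\<beta> - 1) \<le> (2 * h) powr (\<beta> - 1)" using \<beta> by (intro powr_mono2) auto
  also have "\<dots> = 2 powr (\<beta> - 1) * h powr (\<beta> - 1)" using h by (simp add: powr_mult)
  also have "\<dots> \<le> 2 * h powr (\<beta> - 1)"
    using powr_mono[of "\<beta> - 1" 1 "2::real"] \<beta> by (intro mult_right_mono) auto
  finally have "L * \<bar>y - z\<bar> powr (\<beta> - 1) \<le> L * (2 * h powr (\<beta> - 1))" using L by simp
  moreover have "\<bar>f' y - f' z\<bar> \<le> L * \<bar>y - z\<bar> powr (\<beta> - 1)" using f y z01 unfolding in_Sigma_def by blast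
  ultimately show ?thesis using fz by (simp add: algebra_simps)
qed

section \<open>Asymptotics of the bandwidth, the level constant and the error terms\<close>

lemma bw_asymptotics:
  assumes Ch: "0 < Ch \<beta> L \<sigma> K Kmax lam0" and \<beta>: "1 < \<beta>"
  shows "eventually (\<lambda>n. bw \<beta> L \<sigma> K Kmax lam0 n \<le> 1 / 4) sequentially"
    and "eventually (\<lambda>n. 4 \<le> real n * bw \<beta> L \<sigma> K Kmax lam0 n) sequentially"
proof -
  define e c where "e = 1 / (2 * \<beta> + 1)" and "c = Ch \<beta> L \<sigma> K Kmax lam0"
  have e: "0 < e" "e < 1" using \<beta> by (auto simp: e_def)
  have c: "0 < c" using Ch by (simp add: c_def)
  have bw: "bw \<beta> L \<sigma> K Kmax lam0 n = c * (ln (real n) / real n) powr e" for n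
    by (simp add: bw_def c_def e_def)
  show "eventually (\<lambda>n. bw \<beta> L \<sigma> K Kmax lam0 n \<le> 1 / 4) sequentially"
    unfolding bw using e c by real_asymp
  show "eventually (\<lambda>n. 4 \<le> real n * bw \<beta> L \<sigma> K Kmax lam0 n) sequentially"
    unfolding bw using e c by real_asymp
qed

text \<open>Since \<epsilon> is at least 2/n, the number of iterations is at most of order n, and
  \<open>Nmax\<close> is O(n (log n)^2), hence at most \<alpha> n^2 for large n. The bound is
  uniform in \<epsilon> because the functions may change arbitrarily with n.\<close>

lemma eventually_log_Nmax_le:
  assumes \<alpha>: "0 < \<alpha>" "\<alpha> < 1"
  shows "eventually (\<lambda>n. \<forall>\<epsilon>\<ge>2 / real n. \<epsilon> > 0 \<longrightarrow>
    - 2 * ln (\<alpha> / (40 / ln 2 * (- 2 * ln (\<alpha> / 2) / \<epsilon>) * (ln (real n))\<^sup>2)) \<le> 4 * ln (real n)) sequentially"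
proof -
  define c where "c = 40 / ln 2 * (- ln (\<alpha> / 2))"
  have l0: "0 < - ln (\<alpha> / 2)" using \<alpha> by simp
  then have c: "0 < c" unfolding c_def by (intro mult_pos_pos) auto
  have "eventually (\<lambda>n. c * real n * (ln (real n))\<^sup>2 \<le> \<alpha> * (real n)\<^sup>2) sequentially"
    using c \<alpha> by real_asymp
  then show ?thesis using eventually_ge_at_top[of 2]
  proof eventually_elim
    case (elim n)
    show ?case
    proof (intro allI impI)
      fix \<epsilon> assume \<epsilon>: "2 / real n \<le> \<epsilon>" "0 < \<epsilon>"
      define N where "N = 40 / ln 2 * (- 2 * ln (\<alpha> / 2) / \<epsilon>) * (ln (real n))\<^sup>2"
      have ln0: "0 < ln (real n)" using elim by simp
      have "0 < - 2 * ln (\<alpha> / 2) / \<epsilon>" using l0 \<epsilon> by (intro divide_pos_pos) linarith+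
      then have N0: "0 < N" unfolding N_def using ln0 by (intro mult_pos_pos) auto
      have "1 / \<epsilon> \<le> real n / 2" using \<epsilon> elim by (simp add: field_simps)
      then have "2 * c * (1 / \<epsilon>) * (ln (real n))\<^sup>2 \<le> 2 * c * (real n / 2) * (ln (real n))\<^sup>2"
        using c by (intro mult_left_mono mult_right_mono) auto
      then have "N \<le> c * real n * (ln (real n))\<^sup>2" unfolding N_def c_def by (simp add: mult_ac)
      then have "N \<le> \<alpha> * (real n)\<^sup>2" using elim by linarith
      then have "1 / (real n)\<^sup>2 \<le> \<alpha> / N" using N0 elim by (simp add: field_simps)
      then have "ln (1 / (real n)\<^sup>2) \<le> ln (\<alpha> / N)" using elim N0 \<alpha> by (subst ln_le_cancel_iff) auto
      moreover have "ln (1 / (real n)\<^sup>2) = - 2 * ln (real n)" using elim by (simp add: ln_div ln_realpow)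
      ultimately show "- 2 * ln (\<alpha> / (40 / ln 2 * (- 2 * ln (\<alpha> / 2) / \<epsilon>) * (ln (real n))\<^sup>2)) \<le> 4 * ln (real n)"
        unfolding N_def by linarith
    qed
  qed
qed

text \<open>The first term stems from scans that miss the window, the second from local tests that
  accept. Both vanish, and together they are allotted half of \<alpha>.\<close>

lemma eventually_error_le:
  assumes "0 < \<alpha>"
  shows "eventually (\<lambda>n. 2 * (15/16) ^ nat \<lceil>20 * ln (real n)\<rceil> + 4 * (\<kappa> / ln (real n)) \<le> \<alpha> / 2) sequentially"
proof -
  have "filterlim (\<lambda>n. nat \<lceil>20 * ln (real n)\<rceil>) at_top sequentially" by real_asymp
  then have "((\<lambda>n. (15/16::real) ^ nat \<lceil>20 * ln (real n)\<rceil>) \<longlongrightarrow> 0) sequentially"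
    by (rule filterlim_compose[rotated]) (rule LIMSEQ_realpow_zero, auto)
  moreover have "((\<lambda>n. \<kappa> / ln (real n)) \<longlongrightarrow> 0) sequentially" by real_asymp
  ultimately have "((\<lambda>n. 2 * (15/16) ^ nat \<lceil>20 * ln (real n)\<rceil> + 4 * (\<kappa> / ln (real n))) \<longlongrightarrow> 2 * 0 + 4 * 0) sequentially"
    by (intro tendsto_intros)
  then have "eventually (\<lambda>n. 2 * (15/16) ^ nat \<lceil>20 * ln (real n)\<rceil> + 4 * (\<kappa> / ln (real n)) < \<alpha> / 2) sequentially"
    by (rule order_tendstoD) (use assms in simp)
  then show ?thesis by (rule eventually_mono) simp
qed

lemma measurable_fomt_stat:
  "Measurable.pred (data_law \<sigma> g n) (\<lambda>Y. fomt_stat \<beta> L \<sigma> K Kmax LK lam0 \<alpha> Cn n Y i j)"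
proof -
  have [measurable]: "(\<lambda>Y. lpe K n h Y x) \<in> borel_measurable (data_law \<sigma> g n)" for h x
    unfolding lpe_def by (rule measurable_data_law_linear)
  show ?thesis unfolding fomt_stat_def Let_def by measurable
qed

text \<open>Interior and boundary pairs are treated alike, as the correction is always bounded by
  its boundary value. By \<open>bw_power\<close> the Chebyshev bound becomes a constant over log
  n.\<close>

lemma fomt_stat_accept_prob_le:
  assumes \<beta>: "1 < \<beta>" and L: "0 < L" and \<sigma>: "0 < \<sigma>" and LK: "0 \<le> LK" and n: "2 \<le> n"
    and h: "h = bw \<beta> L \<sigma> K Kmax lam0 n"
    and A_def: "A = noise_slope \<beta> L \<sigma> K Kmax LK lam0"
    and kernel: "lpe_kernel K Kmax lam0 h n"
    and Ch: "0 < Ch \<beta> L \<sigma> K Kmax lam0" and A: "4 * (28 * Kmax / lam0 + 2) * L \<le> A"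
    and f: "in_Sigma \<beta> L f f'"
    and lnle: "- 2 * ln (\<alpha> / (40 / ln 2 * Cn * (ln (real n))\<^sup>2)) \<le> 4 * ln (real n)"
    and i: "xpt n i \<in> {0..1}" and j: "xpt n j \<in> {0..1}" and d: "h / 2 \<le> xpt n j - xpt n i"
    and slope: "\<And>z. xpt n i \<le> z \<Longrightarrow> z \<le> xpt n j \<Longrightarrow> f' z \<le> - ((2 * A + 2 * L) * h powr (\<beta> - 1))"
  shows "measure (data_law \<sigma> f n)
      {Y\<in>space (data_law \<sigma> f n). \<not> fomt_stat \<beta> L \<sigma> K Kmax LK lam0 \<alpha> Cn n Y i j}
    \<le> 768 * \<sigma>\<^sup>2 * (Kmax / lam0)\<^sup>2 / A\<^sup>2 / Ch \<beta> L \<sigma> K Kmax lam0 powr (2 * \<beta> + 1) / ln (real n)"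
proof -
  interpret lpe_kernel K Kmax lam0 h n by (rule kernel)
  have L2: "0 \<le> L2c Kmax LK" using Kmax_nonneg LK by (simp add: L2c_def)
  have abs: "\<bar>xpt n i - xpt n j\<bar> = xpt n j - xpt n i" using d h_pos by simp
  have "measure (data_law \<sigma> f n)
      {Y\<in>space (data_law \<sigma> f n). \<not> fomt_stat \<beta> L \<sigma> K Kmax LK lam0 \<alpha> Cn n Y i j}
    \<le> 768 * \<sigma>\<^sup>2 * (Kmax / lam0)\<^sup>2 / A\<^sup>2 / (real n * h powr (2 * \<beta> + 1))"
    unfolding fomt_stat_def Let_def h[symmetric]
  proof (rule pair_accept_prob_le[OF f \<beta> L \<sigma> A i j d slope])
    show "\<sigma> * sqrt (- 2 * ln (\<alpha> / (40 / ln 2 * Cn * (ln (real n))\<^sup>2)) * Wc Kmax LK lam0) * real n powr (-1/2)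
        * h powr (-3/2) * min (8 * L2c Kmax LK / lam0 * \<bar>xpt n i - xpt n j\<bar>) h
        \<le> A * h powr (\<beta> - 1) * (xpt n j - xpt n i)"
      unfolding abs A_def using d h_pos
      by (intro pair_threshold_le[OF Ch \<beta> n h lnle \<sigma> lam0_pos L2]) simp
    have "0 \<le> max (16 * Kmax / lam0) 2 * L * h powr \<beta>"
      using L by (intro mult_nonneg_nonneg) (auto simp: le_max_iff_disj)
    then show "(if xpt n i \<in> {h..1 - h} \<and> xpt n j \<in> {h..1 - h} then 0
        else max (16 * Kmax / lam0) 2 * L * h powr \<beta>) \<le> max (16 * Kmax / lam0) 2 * L * h powr \<beta>"
      by simp
  qed
  also have "\<dots> = 768 * \<sigma>\<^sup>2 * (Kmax / lam0)\<^sup>2 / A\<^sup>2 / Ch \<beta> L \<sigma> K Kmax lam0 powr (2 * \<beta> + 1) / ln (real n)"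
    unfolding h bw_power[OF Ch \<beta> n] by simp
  finally show ?thesis .
qed

theorem mainTheorem6:
  fixes \<beta> L \<sigma> \<alpha> lam0 Kmin Kmax \<Delta> LK :: real
    and K :: "real \<Rightarrow> real"
    and f f' :: "nat \<Rightarrow> real \<Rightarrow> real"
  assumes \<beta>: "1 < \<beta>" "\<beta> \<le> 2"
    and L: "0 < L"
    and \<sigma>: "0 < \<sigma>"
    and \<alpha>: "0 < \<alpha>" "\<alpha> < 1"
    and K_nonneg: "\<forall>u. 0 \<le> K u"
    and K_int: "(K has_integral 1) UNIV"
    and K_supp: "\<forall>u. 1 < \<bar>u\<bar> \<longrightarrow> K u = 0"
    and K_consts: "0 < Kmin" "0 < Kmax" "0 < \<Delta>"
    and K_lower: "\<forall>u. \<bar>u\<bar> \<le> \<Delta> \<longrightarrow> Kmin \<le> K u"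
    and K_upper: "\<forall>u. K u \<le> Kmax"
    and K_lip: "\<forall>u v. \<bar>K u - K v\<bar> \<le> LK * \<bar>u - v\<bar>"
    and K_sym: "\<forall>u. K (- u) = K u"
    and lam0_pos: "0 < lam0"
    and lam0_eig: "eventually (\<lambda>n. \<forall>x\<in>{0..1}.
                   lam0 \<le> lpe_min_eig K n (bw \<beta> L \<sigma> K Kmax lam0 n) x) sequentially"
    and f_Sigma: "\<forall>n\<ge>1. in_Sigma \<beta> L (f n) (f' n)"
    and f_eps: "eventually (\<lambda>n. 2 / real n \<le> eps1 (gam \<beta> L \<sigma> K Kmax LK lam0 n) (f' n)) sequentially"
    and f_D: "eventually (\<lambda>n. Dset (gam \<beta> L \<sigma> K Kmax LK lam0 n) (f' n) \<inter>
                 {bw \<beta> L \<sigma> K Kmax lam0 n + 1 / real n .. 1 - bw \<beta> L \<sigma> K Kmax lam0 n - 1 / real n}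
                 \<noteq> {}) sequentially"
  shows "ereal (1 - \<alpha>) \<le>
    liminf (\<lambda>n. ereal (reject_prob \<sigma> (f n) n (\<lambda>Y.
       let Cn = - 2 * ln (\<alpha> / 2) / eps1 (gam \<beta> L \<sigma> K Kmax LK lam0 n) (f' n)
       in fomt_pmf n (nat \<lceil>Cn\<rceil>) (fomt_stat \<beta> L \<sigma> K Kmax LK lam0 \<alpha> Cn n Y))))"
proof -
  define h where "h = bw \<beta> L \<sigma> K Kmax lam0"
  define A where "A = noise_slope \<beta> L \<sigma> K Kmax LK lam0"
  define eps where "eps n = eps1 (gam \<beta> L \<sigma> K Kmax LK lam0 n) (f' n)" for n
  define Cn where "Cn n = - 2 * ln (\<alpha> / 2) / eps n" for n
  define \<kappa> where "\<kappa> = 768 * \<sigma>\<^sup>2 * (Kmax / lam0)\<^sup>2 / A\<^sup>2 / Ch \<beta> L \<sigma> K Kmax lam0 powr (2 * \<beta> + 1)"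
  have LK: "0 \<le> LK" using K_lip[rule_format, of 0 1] by simp
  note kc = kernel_constants[OF K_nonneg K_int K_supp K_consts(1,3) K_lower K_upper K_lip]
  have kernel: "lpe_kernel K Kmax lam0 (h n) n"
    if "0 < h n" "1 \<le> real n * h n" "\<forall>x\<in>{0..1}. lam0 \<le> lpe_min_eig K n (h n) x" for n
    using that K_nonneg K_upper K_supp lam0_pos by unfold_locales auto
  have Ch: "0 < Ch \<beta> L \<sigma> K Kmax lam0"
    using kc L \<sigma> \<beta> lam0_pos K_consts unfolding Ch_def Let_def Cstar_def by simp
  have hpos: "0 < h n" if "2 \<le> n" for n
    unfolding h_def bw_def using Ch that by simp
  have ev: "eventually (\<lambda>n. 16 \<le> n \<and> h n \<le> 1 / 4 \<and> 4 \<le> real n * h n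
      \<and> (\<forall>x\<in>{0..1}. lam0 \<le> lpe_min_eig K n (h n) x)) sequentially"
    unfolding h_def
    by (intro eventually_conj eventually_ge_at_top bw_asymptotics[OF Ch \<beta>(1)] lam0_eig)
  \<comment> \<open>The inequality lam0 <= 3 Kmax does not involve n, so one sufficiently large
    sample size is enough to derive it.\<close>
  then obtain n0 where n0: "16 \<le> n0" "h n0 \<le> 1 / 4" "4 \<le> real n0 * h n0"
      "\<forall>x\<in>{0..1}. lam0 \<le> lpe_min_eig K n0 (h n0) x"
    using eventually_happens by (metis (mono_tags, lifting) trivial_limit_sequentially)
  have "lam0 \<le> 3 * Kmax"
    using n0 by (intro lpe_kernel.lam0_le[OF kernel[of n0]] hpos) auto
  then have A: "4 * (28 * Kmax / lam0 + 2) * L \<le> A"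
    unfolding A_def using noise_slope_ge[OF \<beta>(1) L \<sigma> lam0_pos _ kc LK] by blast
  \<comment> \<open>For all large n the probability itself is shown to be at least 1 - \<alpha>,
    which implies the bound on the limit inferior.\<close>
  have "eventually (\<lambda>n. 1 - \<alpha> \<le> reject_prob \<sigma> (f n) n (\<lambda>Y. fomt_pmf n (nat \<lceil>Cn n\<rceil>)
      (fomt_stat \<beta> L \<sigma> K Kmax LK lam0 \<alpha> (Cn n) n Y))) sequentially"
    using ev f_eps eventually_log_Nmax_le[OF \<alpha>] eventually_error_le[OF \<alpha>(1), of \<kappa>]
  proof eventually_elim
    case (elim n)
    have n: "16 \<le> n" and h4: "h n \<le> 1 / 4" and nh: "4 \<le> real n * h n" using elim(1) by auto
    have hn: "0 < h n" using hpos n by simp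
    have inv_h: "1 / real n \<le> h n" using n nh by (simp add: field_simps)
    have eps: "2 / real n \<le> eps n" using elim(2) unfolding eps_def .
    have "0 < 2 / real n" using n by simp
    then have eps0: "0 < eps n" using eps by linarith
    have f: "in_Sigma \<beta> L (f n) (f' n)" using f_Sigma n by simp
    define D where "D = Dset (gam \<beta> L \<sigma> K Kmax LK lam0 n) (f' n)"
    define G where "G = {i\<in>{1..n}. \<exists>z\<in>D. \<bar>z - xpt n i\<bar> \<le> 1 / real n}"
    have eG: "eps n \<le> real (card G) / real n"
      using eps1_le_grid_fraction[of n "gam \<beta> L \<sigma> K Kmax LK lam0 n" "f' n"] n eps0
      unfolding eps_def G_def D_def by simp
    have G: "G \<subseteq> {1..n}" "G \<noteq> {}"
    proof -
      show "G \<subseteq> {1..n}" unfolding G_def by blast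
      show "G \<noteq> {}" using eG eps0 by auto
    qed
    \<comment> \<open>\<open>Cbeta\<close> is 4L + 2A, and moving from the set \<open>D\<close> to
      \<open>y\<close> costs 2L.\<close>
    have slope: "f' n y \<le> - ((2 * A + 2 * L) * h n powr (\<beta> - 1))"
      if I: "I \<in> G" and y: "0 \<le> y" "y \<le> 1" "\<bar>y - xpt n I\<bar> \<le> h n" for I y
    proof -
      obtain z where z: "z \<in> D" "\<bar>z - xpt n I\<bar> \<le> 1 / real n" using I by (auto simp: G_def)
      have "f' n y \<le> - ((Cbeta \<beta> L \<sigma> K Kmax LK lam0 - 2 * L) * h n powr (\<beta> - 1))"
        using z y unfolding D_def gam_def h_def[symmetric]
        by (intro slope_near_Dset[OF f \<beta> L hn inv_h]) auto
      also have "Cbeta \<beta> L \<sigma> K Kmax LK lam0 - 2 * L = 2 * A + 2 * L"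
        by (simp add: Cbeta_eq A_def)
      finally show ?thesis .
    qed
    let ?Phi = "\<lambda>Y. fomt_stat \<beta> L \<sigma> K Kmax LK lam0 \<alpha> (Cn n) n Y"
    let ?M = "data_law \<sigma> (f n) n"
    \<comment> \<open>The start \<open>I\<close> may be the left or the right end of the pair; in
      both cases the whole segment lies within h of its design point, where the slope bound
      holds.\<close>
    have pair: "measure ?M {Y\<in>space ?M. \<not> ?Phi Y i j} \<le> \<kappa> / ln (real n)"
      if I: "I \<in> G" and ij: "i = I \<or> j = I" "i < j" "1 \<le> i" "j \<le> n" and win: "j - i \<in> scan_window (real n * h n)" for I i j
    proof -
      have xij: "xpt n j - xpt n i = real (j - i) / real n"
        using ij by (simp add: xpt_def diff_divide_distrib of_nat_diff)
      have dd: "h n / 2 \<le> xpt n j - xpt n i" "xpt n j - xpt n i \<le> h n"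
        using win n unfolding xij scan_window_def by (auto simp: field_simps)
      have x01: "xpt n i \<in> {0..1}" "xpt n j \<in> {0..1}" using ij by (auto simp: xpt_def)
      show ?thesis unfolding \<kappa>_def
      proof (rule fomt_stat_accept_prob_le[OF \<beta>(1) L \<sigma> LK _ _ A_def _ Ch A f _ x01 dd(1)])
        show "2 \<le> n" using n by simp
        show "h n = bw \<beta> L \<sigma> K Kmax lam0 n" by (simp add: h_def)
        show "lpe_kernel K Kmax lam0 (h n) n" using kernel[of n] hn nh elim(1) by simp
        show "- 2 * ln (\<alpha> / (40 / ln 2 * Cn n * (ln (real n))\<^sup>2)) \<le> 4 * ln (real n)"
          unfolding Cn_def using elim(3) eps eps0 by blast
        show "f' n z \<le> - ((2 * A + 2 * L) * h n powr (\<beta> - 1))" if "xpt n i \<le> z" "z \<le> xpt n j" for z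
          using that ij(1) dd x01 by (intro slope[OF I]) auto
      qed
    qed
    let ?m = "nat \<lceil>Cn n\<rceil>"
    have "1 - exp (- (real (card G) / real n * real ?m / 2))
        - 2 * (15/16) ^ nat \<lceil>20 * ln (real n)\<rceil> - 4 * (\<kappa> / ln (real n))
      \<le> (\<integral>Y. pmf (fomt_pmf n ?m (?Phi Y)) True \<partial>?M)"
    proof (rule fomt_reject_lower_bound[OF prob_space_data_law[OF \<sigma>] nh _ G measurable_fomt_stat])
      show "real n * h n \<le> real n / 4" using h4 mult_left_mono[OF h4, of "real n"] by simp
      fix I j assume I: "I \<in> G" and j: "j \<in> scan_window (real n * h n)"
      have I': "1 \<le> I" "I \<le> n" using I G by auto
      have j': "1 \<le> j" "real j \<le> real n / 4"
        using j nh mult_left_mono[OF h4, of "real n"] by (auto simp: scan_window_def)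
      show "measure ?M {Y\<in>space ?M. \<not> ?Phi Y I (I + j)} \<le> \<kappa> / ln (real n)" if "real I \<le> real n / 2"
        using I' j' j that by (intro pair[OF I]) auto
      show "measure ?M {Y\<in>space ?M. \<not> ?Phi Y (I - j) I} \<le> \<kappa> / ln (real n)" if "real n / 2 < real I"
        using I' j' j that by (intro pair[OF I]) auto
    qed
    \<comment> \<open>The ceiling gives at least \<open>Cn n\<close> iterations, and |G|/n is at
      least \<open>eps n\<close>, so their product is at least -2 log(\<alpha>/2). The other half of
      \<alpha> goes to the error terms.\<close>
    moreover have "exp (- (real (card G) / real n * real ?m / 2)) \<le> \<alpha> / 2"
    proof -
      define p where "p = real (card G) / real n * real ?m"
      have Cn0: "0 \<le> Cn n" unfolding Cn_def using \<alpha> eps0 by (intro divide_nonneg_pos) auto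
      have "Cn n \<le> real ?m" by linarith
      have "eps n * Cn n \<le> p"
        unfolding p_def using eG eps0 Cn0 \<open>Cn n \<le> real ?m\<close> by (intro mult_mono) auto
      moreover have "eps n * Cn n = - 2 * ln (\<alpha> / 2)" unfolding Cn_def using eps0 by simp
      ultimately have "- (p / 2) \<le> ln (\<alpha> / 2)" by linarith
      then have "exp (- (p / 2)) \<le> exp (ln (\<alpha> / 2))" by (simp only: exp_le_cancel_iff)
      then show ?thesis unfolding p_def using \<alpha> by simp
    qed
    ultimately show ?case unfolding reject_prob_def using elim(4) by linarith
  qed
  then show ?thesis
    unfolding Cn_def eps_def Let_def by (intro Liminf_bounded) (auto elim!: eventually_mono)
qed

end
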